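(* Let $(F,\nu,\mathbb{A},0)$ be a matrix subshift with vanishing interaction. Then for $n\ge2$ the integral operator $$\mathcal{G}_{\mathbb{A}}:L^2(F,d\nu)\to L^2(F,d\nu),\qquad(\mathcal{G}_{\mathbb{A}}f)(x)=\int_F\mathbb{A}_{\sigma,x}\,f(\sigma)\,d\nu(\sigma)$$ associated with the transition matrix $\mathbb{A}$ satisfies the dynamical trace formula $$Z_n(0)=\nu^n\big(\rho_n(\{\xi\in\Omega_{\mathbb{A}}\mid\tau^n\xi=\xi\})\big)=\mathrm{trace}\,\mathcal{G}_{\mathbb{A}}^n .$$
   Context: A matrix subshift $(F,\nu,\mathbb{A},A)$ consists of a Hausdorff space $F$ with a finite measure $\nu$, a $\nu\otimes\nu$-measurable function $\mathbb{A}:F\times F\to\{0,1\}$ (the transition matrix, written $\mathbb{A}_{x,y}=\mathbb{A}(x,y)$), and an interaction $A\in\mathcal{C}_b(\Omega_{\mathbb{A}})$ (bounded continuous function) on the configuration space $\Omega_{\mathbb{A}}:=\{\xi\in F^{\mathbb{N}}\mid\mathbb{A}(\xi_i,\xi_{i+1})=1\ \forall i\}$, together with the left shift $\tau:F^{\mathbb{N}}\to F^{\mathbb{N}}$, $(\tau\xi)_k=\xi_{k+1}$. The dynamical partition function is $$Z_n(A):=\int_{F^n}\prod_{i=1}^n\mathbb{A}_{x_i,x_{i+1}}\exp\Big(\sum_{k=0}^{n-1}A(\tau^k(\overline{x_1\ldots x_n}))\Big)\,d\nu^n(x_1,\ldots,x_n),$$ where $\overline{x_1\ldots x_n}=(x_1,\ldots,x_n,x_1,\ldots,x_n,\ldots)$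 and $x_{n+1}:=x_1$. The map $\rho_n:F^{\mathbb{N}}\to F^n$ is $\xi\mapsto(\xi_1,\ldots,\xi_n)$. *)

theory Defs
  imports "HOL-Analysis.Analysis"
begin

section \<open>Matrix subshifts\<close>

text \<open>
  One-sided sequences and $n$-tuples are indexed from 0, so the letter $\xi_i$ (with $i \ge 1$) is
  \<open>\<xi> (i - 1)\<close>.  The $n$-fold product $(F^n, \nu^n)$ is \<open>PiM {..<n} (\<lambda>_. \<nu>)\<close>, whose points are the
  functions \<open>nat \<Rightarrow> 'a\<close> that are \<open>undefined\<close> outside \<open>{..<n}\<close>.
\<close>

definition config_space :: "('a \<Rightarrow> 'a \<Rightarrow> real) \<Rightarrow> (nat \<Rightarrow> 'a) set" where
  "config_space \<AA> = {\<xi>. \<forall>i. \<AA> (\<xi> i) (\<xi> (Suc i)) = 1}"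

definition left_shift :: "(nat \<Rightarrow> 'a) \<Rightarrow> nat \<Rightarrow> 'a" where
  "left_shift \<xi> = (\<lambda>k. \<xi> (Suc k))"

definition periodic_extension :: "nat \<Rightarrow> (nat \<Rightarrow> 'a) \<Rightarrow> nat \<Rightarrow> 'a" where
  "periodic_extension n x = (\<lambda>k. x (k mod n))"

definition initial_word :: "nat \<Rightarrow> (nat \<Rightarrow> 'a) \<Rightarrow> nat \<Rightarrow> 'a" where
  "initial_word n \<xi> = restrict \<xi> {..<n}"

text \<open>
  Continuity of the interaction refers to the product topology on \<open>nat \<Rightarrow> 'a\<close>.  The values of \<open>A\<close>
  outside the configuration space are irrelevant: in the partition function they are multiplied by 0.
\<close>

locale matrix_subshift = finite_measure \<nu>
  for \<nu> :: "'a::t2_space measure" +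
  fixes \<AA> :: "'a \<Rightarrow> 'a \<Rightarrow> real" and A :: "(nat \<Rightarrow> 'a) \<Rightarrow> complex"
  assumes space_eq_UNIV: "space \<nu> = UNIV"
    and transition_matrix_values: "\<And>x y. \<AA> x y \<in> {0, 1}"
    and transition_matrix_measurable: "(\<lambda>(x, y). \<AA> x y) \<in> borel_measurable (\<nu> \<Otimes>\<^sub>M \<nu>)"
    and interaction_continuous: "continuous_on (config_space \<AA>) A"
    and interaction_bounded: "bounded (A ` config_space \<AA>)"

definition dyn_partition_function ::
    "'a measure \<Rightarrow> ('a \<Rightarrow> 'a \<Rightarrow> real) \<Rightarrow> ((nat \<Rightarrow> 'a) \<Rightarrow> complex) \<Rightarrow> nat \<Rightarrow> complex" where
  "dyn_partition_function \<nu> \<AA> A n =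
     (\<integral>x. (\<Prod>i<n. complex_of_real (\<AA> (x i) (x (Suc i mod n)))) *
          exp (\<Sum>k<n. A ((left_shift ^^ k) (periodic_extension n x)))
      \<partial>PiM {..<n} (\<lambda>_. \<nu>))"

section \<open>The Hilbert space $L^2$, trace-class operators and the trace\<close>

text \<open>
  Elements of $L^2$ are handled through representatives: square-integrable functions, equality in
  $L^2$ being equality almost everywhere.
\<close>

definition L2 :: "'a measure \<Rightarrow> ('a \<Rightarrow> complex) set" where
  "L2 M = {f \<in> borel_measurable M. integrable M (\<lambda>x. (norm (f x))\<^sup>2)}"

definition l2_inner :: "'a measure \<Rightarrow> ('a \<Rightarrow> complex) \<Rightarrow> ('a \<Rightarrow> complex) \<Rightarrow> complex" where
  "l2_inner M f g = (\<integral>x. f x * cnj (g x) \<partial>M)"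

definition l2_norm :: "'a measure \<Rightarrow> ('a \<Rightarrow> complex) \<Rightarrow> real" where
  "l2_norm M f = sqrt (\<integral>x. (norm (f x))\<^sup>2 \<partial>M)"

text \<open>
  Bounded linear operators on $L^2$.  Linearity and boundedness together imply that functions that
  agree almost everywhere have images that agree almost everywhere.
\<close>

definition l2_operator :: "'a measure \<Rightarrow> (('a \<Rightarrow> complex) \<Rightarrow> ('a \<Rightarrow> complex)) \<Rightarrow> bool" where
  "l2_operator M T \<longleftrightarrow>
     (\<forall>f\<in>L2 M. T f \<in> L2 M) \<and>
     (\<forall>f\<in>L2 M. \<forall>g\<in>L2 M. \<forall>a b.
        AE x in M. T (\<lambda>y. a * f y + b * g y) x = a * T f x + b * T g x) \<and>
     (\<exists>C. \<forall>f\<in>L2 M. l2_norm M (T f) \<le> C * l2_norm M f)"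

text \<open>
  Trace-class operators are the nuclear operators $T = \sum_k \langle \cdot, u_k\rangle v_k$ with
  $\sum_k \|u_k\| \|v_k\| < \infty$.
\<close>

definition l2_trace_class :: "'a measure \<Rightarrow> (('a \<Rightarrow> complex) \<Rightarrow> ('a \<Rightarrow> complex)) \<Rightarrow> bool" where
  "l2_trace_class M T \<longleftrightarrow> l2_operator M T \<and>
     (\<exists>u v :: nat \<Rightarrow> 'a \<Rightarrow> complex.
        (\<forall>k. u k \<in> L2 M \<and> v k \<in> L2 M) \<and>
        summable (\<lambda>k. l2_norm M (u k) * l2_norm M (v k)) \<and>
        (\<forall>f\<in>L2 M.
           (\<lambda>N. l2_norm M (\<lambda>x. T f x - (\<Sum>k<N. l2_inner M f (u k) * v k x))) \<longlonglongrightarrow> 0))"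

text \<open>
  The space need not be separable, so bases may be uncountable.  Distinct members of a basis
  represent distinct elements of $L^2$, by orthonormality.
\<close>

definition l2_orthonormal_basis :: "'a measure \<Rightarrow> ('a \<Rightarrow> complex) set \<Rightarrow> bool" where
  "l2_orthonormal_basis M E \<longleftrightarrow> E \<subseteq> L2 M \<and>
     (\<forall>e\<in>E. \<forall>e'\<in>E. l2_inner M e e' = (if e = e' then 1 else 0)) \<and>
     (\<forall>f\<in>L2 M. (\<forall>e\<in>E. l2_inner M f e = 0) \<longrightarrow> (AE x in M. f x = 0))"

text \<open>For trace-class operators the sum converges and does not depend on the chosen basis.\<close>

definition l2_trace :: "'a measure \<Rightarrow> (('a \<Rightarrow> complex) \<Rightarrow> ('a \<Rightarrow> complex)) \<Rightarrow> complex" where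
  "l2_trace M T = (\<Sum>\<^sub>\<infinity>e\<in>(SOME E. l2_orthonormal_basis M E). l2_inner M (T e) e)"

section \<open>The integral operator of the transition matrix\<close>

definition transition_operator ::
    "'a measure \<Rightarrow> ('a \<Rightarrow> 'a \<Rightarrow> real) \<Rightarrow> ('a \<Rightarrow> complex) \<Rightarrow> 'a \<Rightarrow> complex" where
  "transition_operator \<nu> \<AA> f = (\<lambda>x. \<integral>\<sigma>. complex_of_real (\<AA> \<sigma> x) * f \<sigma> \<partial>\<nu>)"

end

theory Submission
  imports Defs
begin

text \<open>
  Write $G$ for the transition operator and $G^*$ for the operator of the transposed matrix, which
  is its adjoint. Both are Hilbert--Schmidt: for fixed $x$ the number $(Ge)(x)$ is the inner
  product of $e$ with the column $\mathbb{A}(\cdot, x)$, so Bessel's inequality in each $x$ and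
  integration give $\sum_e \|Ge\|^2 \le \int\int \mathbb{A}^2 < \infty$ for every orthonormal
  system (\<open>transition_operator_Hilbert_Schmidt\<close>). For $n \ge 2$ the power $G^n = G
  \circ G^{n-1}$ is a product of two Hilbert--Schmidt operators. Expanding $G^{n-1} f$ in an
  orthonormal basis turns it into $G^n f = \sum_e \langle f, (G^*)^{n-1} e\rangle\, Ge$, a nuclear
  representation because of the Cauchy--Schwarz inequality (\<open>l2_trace_class_comp\<close>).

  The trace of $G^n$ is $\sum_e \langle Ge, (G^*)^{n-1} e\rangle$. The obvious way to evaluate it,
  by Parseval's identity at almost every point $x$, is delicate for an uncountable basis: the null
  sets on which the individual terms may be changed need not have a null union. Instead, the trace
  is regarded as a function of the set $S$ of edges of which $\mathbb{A}$ is the indicator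
  function: the second factor $(G^*)^{n-1}$ is kept fixed while $S$ varies over all measurable
  subsets of $F \times F$ (\<open>pairing_has_sum_measure\<close>). As functions of $S$, both the
  trace pairing $\sum_e \langle T_S e, (G^*)^{n-1} e\rangle$ and the measure of the set of
  admissible paths $x_1, \ldots, x_n$ with $(x_n, x_1) \in S$ are additive; the former is bounded
  by a constant times the square root of the measure of $S$, hence countably additive. So it
  suffices that they agree on rectangles. For $S = B \times C$ the operator $T_S$ has rank one,
  and Parseval's identity collapses the pairing to $\langle G^{n-1} 1_C, 1_B\rangle$, which is the
  measure of the set of admissible paths from $C$ to $B$ by an iteration of Fubini's theorem
  (\<open>path_integral\<close>).

  Finally, a point of period $n$ is determined by its initial word, and the words that occur are
  the cyclic ones (\<open>initial_words_of_periodic_points\<close>); their indicator function is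
  the integrand of the partition function when the interaction vanishes.
\<close>

section \<open>Square-integrable functions as a semi-inner product space\<close>

lemma L2_measurable [measurable_dest]: "f \<in> L2 M \<Longrightarrow> f \<in> borel_measurable M"
  by (simp add: L2_def)

lemma L2_integrable: "f \<in> L2 M \<Longrightarrow> integrable M (\<lambda>x. (norm (f x))\<^sup>2)"
  by (simp add: L2_def)

lemma L2_zero [simp]: "(\<lambda>_. 0) \<in> L2 M"
  by (simp add: L2_def)

lemma L2_add:
  assumes "f \<in> L2 M" "g \<in> L2 M"
  shows "(\<lambda>x. f x + g x) \<in> L2 M"
proof -
  note [measurable] = assms[THEN L2_measurable]
  have "integrable M (\<lambda>x. (norm (f x + g x))\<^sup>2)"
  proof (rule Bochner_Integration.integrable_bound)
    show "integrable M (\<lambda>x. 2 * (norm (f x))\<^sup>2 + 2 * (norm (g x))\<^sup>2)"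
      using assms[THEN L2_integrable] by simp
    have "(norm (a + b))\<^sup>2 \<le> 2 * (norm a)\<^sup>2 + 2 * (norm b)\<^sup>2" for a b :: complex
    proof -
      have "(norm (a + b))\<^sup>2 \<le> (norm a + norm b)\<^sup>2"
        by (intro power_mono norm_triangle_ineq norm_ge_zero)
      also have "\<dots> \<le> 2 * (norm a)\<^sup>2 + 2 * (norm b)\<^sup>2"
        using zero_le_power2[of "norm a - norm b"] by (simp add: power2_sum power2_diff)
      finally show ?thesis .
    qed
    then show "AE x in M. norm ((norm (f x + g x))\<^sup>2) \<le> norm (2 * (norm (f x))\<^sup>2 + 2 * (norm (g x))\<^sup>2)"
      by auto
  qed measurable
  then show ?thesis by (simp add: L2_def)
qed

lemma L2_cmult: "f \<in> L2 M \<Longrightarrow> (\<lambda>x. c * f x) \<in> L2 M"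
  unfolding L2_def
  by (auto simp: norm_mult power_mult_distrib
      intro!: borel_measurable_times integrable_mult_right)

lemma L2_diff: "f \<in> L2 M \<Longrightarrow> g \<in> L2 M \<Longrightarrow> (\<lambda>x. f x - g x) \<in> L2 M"
  using L2_add[of f M "\<lambda>x. (-1) * g x"] L2_cmult[of g M "-1"] by simp

lemma L2_sum: "(\<And>i. i \<in> I \<Longrightarrow> f i \<in> L2 M) \<Longrightarrow> (\<lambda>x. \<Sum>i\<in>I. f i x) \<in> L2 M"
  by (induction I rule: infinite_finite_induct) (auto intro: L2_add)

lemma L2_cnj:
  assumes "f \<in> L2 M"
  shows "(\<lambda>x. cnj (f x)) \<in> L2 M"
proof -
  have "cnj \<in> borel_measurable borel"
    by (rule borel_measurable_continuous_onI) (rule continuous_on_cnj[OF continuous_on_id])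
  from measurable_compose[OF L2_measurable[OF assms] this] L2_integrable[OF assms]
  show ?thesis by (simp add: L2_def)
qed

lemma L2_mult_integrable:
  assumes "f \<in> L2 M" "g \<in> L2 M"
  shows "integrable M (\<lambda>x. f x * g x)"
proof (rule Bochner_Integration.integrable_bound)
  note [measurable] = assms[THEN L2_measurable]
  show "integrable M (\<lambda>x. (norm (f x))\<^sup>2 + (norm (g x))\<^sup>2)"
    using assms[THEN L2_integrable] by simp
  have "a * b \<le> a\<^sup>2 + b\<^sup>2" if "a \<ge> 0" "b \<ge> 0" for a b :: real
    using zero_le_power2[of "a - b"] mult_nonneg_nonneg[OF that] by (simp add: power2_diff)
  then show "AE x in M. norm (f x * g x) \<le> norm ((norm (f x))\<^sup>2 + (norm (g x))\<^sup>2)"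
    by (auto simp: norm_mult)
  show "(\<lambda>x. f x * g x) \<in> borel_measurable M" by measurable
qed

lemma l2_inner_integrable: "f \<in> L2 M \<Longrightarrow> g \<in> L2 M \<Longrightarrow> integrable M (\<lambda>x. f x * cnj (g x))"
  by (intro L2_mult_integrable L2_cnj)

lemma l2_inner_add_left:
  "f \<in> L2 M \<Longrightarrow> g \<in> L2 M \<Longrightarrow> h \<in> L2 M \<Longrightarrow>
    l2_inner M (\<lambda>x. f x + g x) h = l2_inner M f h + l2_inner M g h"
  unfolding l2_inner_def distrib_right
  by (intro Bochner_Integration.integral_add l2_inner_integrable)

lemma l2_inner_diff_left:
  "f \<in> L2 M \<Longrightarrow> g \<in> L2 M \<Longrightarrow> h \<in> L2 M \<Longrightarrow>
    l2_inner M (\<lambda>x. f x - g x) h = l2_inner M f h - l2_inner M g h"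
  unfolding l2_inner_def left_diff_distrib
  by (intro Bochner_Integration.integral_diff l2_inner_integrable)

lemma l2_inner_cmult_left: "l2_inner M (\<lambda>x. c * f x) g = c * l2_inner M f g"
  unfolding l2_inner_def by (simp add: mult.assoc)

lemma l2_inner_sum_left:
  assumes "\<And>i. i \<in> I \<Longrightarrow> f i \<in> L2 M" "g \<in> L2 M"
  shows "l2_inner M (\<lambda>x. \<Sum>i\<in>I. f i x) g = (\<Sum>i\<in>I. l2_inner M (f i) g)"
  unfolding l2_inner_def sum_distrib_right
  by (intro Bochner_Integration.integral_sum l2_inner_integrable assms)

lemma cnj_l2_inner: "cnj (l2_inner M f g) = l2_inner M g f"
  unfolding l2_inner_def Bochner_Integration.integral_cnj[symmetric] by (simp add: mult.commute)

lemma norm_l2_inner_commute: "norm (l2_inner M f g) = norm (l2_inner M g f)"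
  unfolding cnj_l2_inner[of M g f, symmetric] by simp

lemma l2_norm_nonneg [simp]: "l2_norm M f \<ge> 0"
  by (simp add: l2_norm_def)

lemma l2_norm_sq: "(l2_norm M f)\<^sup>2 = (\<integral>x. (norm (f x))\<^sup>2 \<partial>M)"
  by (simp add: l2_norm_def)

lemma l2_inner_self: "l2_inner M f f = complex_of_real ((l2_norm M f)\<^sup>2)"
  unfolding l2_inner_def l2_norm_sq
  by (simp only: integral_complex_of_real[symmetric] complex_norm_square)

lemma l2_norm_cong_AE:
  assumes "f \<in> borel_measurable M" "g \<in> borel_measurable M" "AE x in M. f x = g x"
  shows "l2_norm M f = l2_norm M g"
proof -
  note [measurable] = assms(1,2)
  have "(\<integral>x. (norm (f x))\<^sup>2 \<partial>M) = (\<integral>x. (norm (g x))\<^sup>2 \<partial>M)"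
    using assms(3) by (intro integral_cong_AE) auto
  then show ?thesis by (simp add: l2_norm_def)
qed

lemma l2_norm_eq_0_iff:
  assumes "f \<in> L2 M"
  shows "l2_norm M f = 0 \<longleftrightarrow> (AE x in M. f x = 0)"
  using integral_nonneg_eq_0_iff_AE[OF L2_integrable[OF assms]] by (simp add: l2_norm_def)

lemma l2_norm_cmult: "l2_norm M (\<lambda>x. c * f x) = norm c * l2_norm M f"
  by (simp add: l2_norm_def norm_mult power_mult_distrib real_sqrt_mult)

lemma l2_norm_minus_commute: "l2_norm M (\<lambda>x. f x - g x) = l2_norm M (\<lambda>x. g x - f x)"
  unfolding l2_norm_def by (subst norm_minus_commute) (rule refl)

lemma l2_norm_cnj: "l2_norm M (\<lambda>x. cnj (f x)) = l2_norm M f"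
  by (simp add: l2_norm_def)

text \<open>
  The bound on the integral of $|fg|$, and not only on the inner product, also controls $L^1$
  norms by $L^2$ norms.
\<close>

lemma l2_Cauchy_Schwarz_integral:
  assumes "f \<in> L2 M" "g \<in> L2 M"
  shows "(\<integral>x. norm (f x * g x) \<partial>M) \<le> l2_norm M f * l2_norm M g"
proof -
  note [measurable] = assms[THEN L2_measurable]
  have "integrable M (\<lambda>x. norm (f x * g x))"
    using L2_mult_integrable[OF assms] by (rule integrable_norm)
  then have "ennreal (\<integral>x. norm (f x * g x) \<partial>M) = (\<integral>\<^sup>+x. norm (f x * g x) \<partial>M)"
    by (subst nn_integral_eq_integral) auto
  then have "ennreal ((\<integral>x. norm (f x * g x) \<partial>M)\<^sup>2) = (\<integral>\<^sup>+x. norm (f x) * norm (g x) \<partial>M)\<^sup>2"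
    by (subst ennreal_power[symmetric]) (simp_all only: norm_mult, simp)
  also have "\<dots> \<le> (\<integral>\<^sup>+x. (ennreal (norm (f x)))\<^sup>2 \<partial>M) * (\<integral>\<^sup>+x. (ennreal (norm (g x)))\<^sup>2 \<partial>M)"
    using Cauchy_Schwarz_nn_integral[of "\<lambda>x. ennreal (norm (f x))" M "\<lambda>x. ennreal (norm (g x))"]
    by (simp add: ennreal_mult)
  also have "\<dots> = ennreal ((l2_norm M f)\<^sup>2 * (l2_norm M g)\<^sup>2)"
    using assms[THEN L2_integrable]
    by (simp add: nn_integral_eq_integral ennreal_power l2_norm_sq ennreal_mult)
  finally have "(\<integral>x. norm (f x * g x) \<partial>M)\<^sup>2 \<le> (l2_norm M f * l2_norm M g)\<^sup>2"
    by (simp add: power_mult_distrib)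
  then show ?thesis by (rule power2_le_imp_le) simp
qed

lemma l2_Cauchy_Schwarz:
  assumes "f \<in> L2 M" "g \<in> L2 M"
  shows "norm (l2_inner M f g) \<le> l2_norm M f * l2_norm M g"
proof -
  have "norm (l2_inner M f g) \<le> (\<integral>x. norm (f x * cnj (g x)) \<partial>M)"
    unfolding l2_inner_def by (rule integral_norm_bound)
  also have "\<dots> \<le> l2_norm M f * l2_norm M g"
    using l2_Cauchy_Schwarz_integral[OF assms(1) L2_cnj[OF assms(2)]] by (simp only: l2_norm_cnj)
  finally show ?thesis .
qed

lemma l2_norm_diff_sq:
  assumes "f \<in> L2 M" "g \<in> L2 M"
  shows "(l2_norm M (\<lambda>x. f x - g x))\<^sup>2 =
    (l2_norm M f)\<^sup>2 - 2 * Re (l2_inner M f g) + (l2_norm M g)\<^sup>2"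
proof -
  have d: "(\<lambda>x. f x - g x) \<in> L2 M" using assms by (rule L2_diff)
  have r: "l2_inner M h (\<lambda>x. f x - g x) = l2_inner M h f - l2_inner M h g" if "h \<in> L2 M" for h
    using l2_inner_diff_left[OF assms that] by (metis cnj_l2_inner complex_cnj_diff)
  have "complex_of_real ((l2_norm M (\<lambda>x. f x - g x))\<^sup>2) =
      l2_inner M f f - l2_inner M f g - (l2_inner M g f - l2_inner M g g)"
    using assms d by (simp only: l2_inner_diff_left r l2_inner_self[symmetric])
  also have "Re \<dots> = (l2_norm M f)\<^sup>2 - 2 * Re (l2_inner M f g) + (l2_norm M g)\<^sup>2"
    unfolding l2_inner_self cnj_l2_inner[of M f g, symmetric] by simp
  finally show ?thesis by (metis Re_complex_of_real)
qed

lemma l2_norm_triangle_diff: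
  assumes "f \<in> L2 M" "g \<in> L2 M"
  shows "l2_norm M (\<lambda>x. f x - g x) \<le> l2_norm M f + l2_norm M g"
proof (rule power2_le_imp_le)
  have "- Re (l2_inner M f g) \<le> l2_norm M f * l2_norm M g"
    using l2_Cauchy_Schwarz[OF assms] abs_Re_le_cmod[of "l2_inner M f g"] by linarith
  then show "(l2_norm M (\<lambda>x. f x - g x))\<^sup>2 \<le> (l2_norm M f + l2_norm M g)\<^sup>2"
    unfolding l2_norm_diff_sq[OF assms] by (simp add: power2_sum)
qed simp

lemma l2_norm_triangle:
  assumes "f \<in> L2 M" "g \<in> L2 M"
  shows "l2_norm M (\<lambda>x. f x + g x) \<le> l2_norm M f + l2_norm M g"
  using l2_norm_triangle_diff[OF assms(1) L2_cmult[OF assms(2), of "-1"]]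
    l2_norm_cmult[of M "-1" g] by simp

section \<open>Completeness of $L^2$ over a finite measure\<close>

lemma (in finite_measure) L2_bounded:
  assumes "f \<in> borel_measurable M" "\<And>x. x \<in> space M \<Longrightarrow> norm (f x) \<le> B"
  shows "f \<in> L2 M"
proof -
  note [measurable] = assms(1)
  have "integrable M (\<lambda>x. (norm (f x))\<^sup>2)"
    using assms(2) by (intro integrable_const_bound[where B = "B\<^sup>2"]) (auto intro!: power_mono AE_I2)
  with assms(1) show ?thesis by (simp add: L2_def)
qed

lemma (in finite_measure) L2_imp_integrable:
  assumes "f \<in> L2 M"
  shows "integrable M f"
  using L2_mult_integrable[OF assms L2_bounded[of "\<lambda>_. 1" 1]] by simp

lemma (in finite_measure) L1_norm_le_l2_norm:
  assumes "f \<in> L2 M"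
  shows "(\<integral>x. norm (f x) \<partial>M) \<le> l2_norm M f * sqrt (measure M (space M))"
  using l2_Cauchy_Schwarz_integral[OF assms L2_bounded[of "\<lambda>_. 1" 1]]
  by (simp add: l2_norm_def)

text \<open>
  Over a finite measure the $L^1$ norms of the increments decrease geometrically as well, so by
  monotone convergence the sum of the absolute increments is finite almost everywhere.
\<close>

lemma (in finite_measure) l2_geometric_increments_AE_convergent:
  assumes g: "\<And>k. g k \<in> L2 M"
    and inc: "\<And>k. l2_norm M (\<lambda>x. g (Suc k) x - g k x) \<le> (1/2) ^ k"
  shows "AE x in M. convergent (\<lambda>k. g k x)"
proof -
  note [measurable] = g[THEN L2_measurable]
  define c where "c = sqrt (measure M (space M))"
  let ?d = "\<lambda>k x. norm (g (Suc k) x - g k x)"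
  have d: "(\<lambda>x. g (Suc k) x - g k x) \<in> L2 M" for k by (intro L2_diff g)
  have int: "(\<integral>\<^sup>+x. ennreal (?d k x) \<partial>M) \<le> ennreal ((1/2) ^ k * c)" for k
  proof -
    have "(\<integral>x. ?d k x \<partial>M) \<le> (1/2) ^ k * c"
      using L1_norm_le_l2_norm[OF d[of k]] mult_right_mono[OF inc[of k], of c]
      by (simp add: c_def)
    moreover have "integrable M (?d k)"
      using L2_imp_integrable[OF d] by (rule integrable_norm)
    ultimately show ?thesis by (simp add: nn_integral_eq_integral ennreal_leI)
  qed
  have geo: "summable (\<lambda>k. (1/2::real) ^ k * c)" by (intro summable_mult2 summable_geometric) simp
  have "(\<integral>\<^sup>+x. (\<Sum>k. ennreal (?d k x)) \<partial>M) = (\<Sum>k. \<integral>\<^sup>+x. ennreal (?d k x) \<partial>M)"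
    by (rule nn_integral_suminf) measurable
  also have "\<dots> \<le> (\<Sum>k. ennreal ((1/2) ^ k * c))"
    by (intro suminf_le int) auto
  also have "\<dots> = ennreal (\<Sum>k. (1/2) ^ k * c)"
    using geo by (intro suminf_ennreal2) (auto simp: c_def)
  finally have "(\<integral>\<^sup>+x. (\<Sum>k. ennreal (?d k x)) \<partial>M) \<noteq> \<infinity>"
    by (auto simp: top_unique)
  then have "AE x in M. (\<Sum>k. ennreal (?d k x)) \<noteq> \<infinity>"
    by (intro nn_integral_PInf_AE) measurable
  then show ?thesis
  proof eventually_elim
    case (elim x)
    then have "summable (\<lambda>k. ?d k x)" by (intro summable_suminf_not_top) auto
    then have "summable (\<lambda>k. g (Suc k) x - g k x)" by (rule summable_norm_cancel)
    then have "convergent (\<lambda>n. \<Sum>k<n. g (Suc k) x - g k x)" by (simp add: summable_iff_convergent)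
    then have "convergent (\<lambda>n. g n x - g 0 x)" by (simp only: sum_lessThan_telescope[of "\<lambda>k. g k x"])
    then show ?case using convergent_diff_const_right_iff by blast
  qed
qed

lemma l2_geometric_increments_tail:
  assumes g: "\<And>k. g k \<in> L2 M"
    and inc: "\<And>k. l2_norm M (\<lambda>x. g (Suc k) x - g k x) \<le> (1/2) ^ k"
  shows "l2_norm M (\<lambda>x. g (k + m) x - g k x) \<le> 2 * (1/2) ^ k - 2 * (1/2) ^ (k + m)"
proof (induction m)
  case 0
  then show ?case by (simp add: l2_norm_def)
next
  case (Suc m)
  have "l2_norm M (\<lambda>x. g (k + Suc m) x - g k x) =
      l2_norm M (\<lambda>x. (g (Suc (k + m)) x - g (k + m) x) + (g (k + m) x - g k x))"
    by simp
  also have "\<dots> \<le> (1/2) ^ (k + m) + (2 * (1/2) ^ k - 2 * (1/2) ^ (k + m))"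
    by (rule order_trans[OF l2_norm_triangle]) (intro L2_diff g add_mono inc Suc.IH)+
  finally show ?case by simp
qed

text \<open>
  The form of the Riesz--Fischer theorem needed for orthogonal expansions: a sequence with
  geometrically small increments has an $L^2$ limit.  The limit is the pointwise one, and Fatou's
  lemma carries the tail estimates over to it.
\<close>

lemma (in finite_measure) L2_complete:
  assumes g: "\<And>k. g k \<in> L2 M"
    and inc: "\<And>k. l2_norm M (\<lambda>x. g (Suc k) x - g k x) \<le> (1/2) ^ k"
  obtains h where "h \<in> L2 M" "(\<lambda>k. l2_norm M (\<lambda>x. g k x - h x)) \<longlonglongrightarrow> 0"
proof -
  note [measurable] = g[THEN L2_measurable]
  define h where "h x = lim (\<lambda>k. g k x)" for x
  have [measurable]: "h \<in> borel_measurable M" unfolding h_def by measurable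
  have conv: "AE x in M. (\<lambda>k. g k x) \<longlonglongrightarrow> h x"
    using l2_geometric_increments_AE_convergent[OF assms]
    by eventually_elim (simp add: h_def convergent_LIMSEQ_iff)
  have tail: "(\<integral>\<^sup>+x. ennreal ((norm (g k x - h x))\<^sup>2) \<partial>M) \<le> ennreal ((2 * (1/2) ^ k)\<^sup>2)" for k
  proof -
    let ?u = "\<lambda>m x. ennreal ((norm (g (k + m) x - g k x))\<^sup>2)"
    have "(\<integral>\<^sup>+x. ennreal ((norm (g k x - h x))\<^sup>2) \<partial>M) = (\<integral>\<^sup>+x. liminf (\<lambda>m. ?u m x) \<partial>M)"
    proof (rule nn_integral_cong_AE, use conv in eventually_elim)
      case (elim x)
      have "(\<lambda>m. g (m + k) x) \<longlonglongrightarrow> h x" by (rule LIMSEQ_ignore_initial_segment[OF elim])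
      then have "(\<lambda>m. ?u m x) \<longlonglongrightarrow> ennreal ((norm (h x - g k x))\<^sup>2)"
        by (intro tendsto_intros) (simp add: add.commute)
      then have "liminf (\<lambda>m. ?u m x) = ennreal ((norm (h x - g k x))\<^sup>2)"
        by (intro lim_imp_Liminf) auto
      then show ?case by (simp add: norm_minus_commute)
    qed
    also have "\<dots> \<le> liminf (\<lambda>m. \<integral>\<^sup>+x. ?u m x \<partial>M)"
      by (rule nn_integral_liminf) measurable
    also have "\<dots> \<le> limsup (\<lambda>m. \<integral>\<^sup>+x. ?u m x \<partial>M)"
      by (rule Liminf_le_Limsup) simp
    also have "\<dots> \<le> ennreal ((2 * (1/2) ^ k)\<^sup>2)"
    proof (intro Limsup_bounded always_eventually allI)
      fix m
      have d: "(\<lambda>x. g (k + m) x - g k x) \<in> L2 M" by (intro L2_diff g)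
      have "l2_norm M (\<lambda>x. g (k + m) x - g k x) \<le> 2 * (1/2) ^ k"
        using l2_geometric_increments_tail[of g M k m, OF assms]
          zero_le_power[of "1/2::real" "k + m"] by linarith
      then have "(l2_norm M (\<lambda>x. g (k + m) x - g k x))\<^sup>2 \<le> (2 * (1/2) ^ k)\<^sup>2"
        by (intro power_mono) auto
      then show "(\<integral>\<^sup>+x. ?u m x \<partial>M) \<le> ennreal ((2 * (1/2) ^ k)\<^sup>2)"
        using L2_integrable[OF d] by (simp only: l2_norm_sq nn_integral_eq_integral
            AE_I2 zero_le_power2 ennreal_leI)
    qed
    finally show ?thesis .
  qed
  have gh: "(\<lambda>x. g k x - h x) \<in> L2 M" for k
  proof -
    have "integrable M (\<lambda>x. (norm (g k x - h x))\<^sup>2)"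
    proof (rule integrableI_bounded)
      show "(\<integral>\<^sup>+x. ennreal (norm ((norm (g k x - h x))\<^sup>2)) \<partial>M) < \<infinity>"
        using tail[of k] by (auto intro: le_less_trans)
    qed measurable
    then show ?thesis by (simp add: L2_def)
  qed
  have "(\<lambda>x. g 0 x - (g 0 x - h x)) \<in> L2 M" by (intro L2_diff g gh)
  then have "h \<in> L2 M" by simp
  moreover have "(\<lambda>k. l2_norm M (\<lambda>x. g k x - h x)) \<longlonglongrightarrow> 0"
  proof (rule tendsto_sandwich[OF _ _ tendsto_const])
    show "\<forall>\<^sub>F k in sequentially. 0 \<le> l2_norm M (\<lambda>x. g k x - h x)" by simp
    have "l2_norm M (\<lambda>x. g k x - h x) \<le> 2 * (1/2) ^ k" for k
    proof (rule power2_le_imp_le)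
      have "ennreal ((l2_norm M (\<lambda>x. g k x - h x))\<^sup>2) \<le> ennreal ((2 * (1/2) ^ k)\<^sup>2)"
        using tail[of k] L2_integrable[OF gh[of k]]
        by (simp only: l2_norm_sq nn_integral_eq_integral AE_I2 zero_le_power2)
      then show "(l2_norm M (\<lambda>x. g k x - h x))\<^sup>2 \<le> (2 * (1/2) ^ k)\<^sup>2"
        by (subst (asm) ennreal_le_iff) simp_all
    qed simp
    then show "\<forall>\<^sub>F k in sequentially. l2_norm M (\<lambda>x. g k x - h x) \<le> 2 * (1/2) ^ k" by simp
    show "(\<lambda>k. 2 * (1/2::real) ^ k) \<longlonglongrightarrow> 0"
      by (intro tendsto_mult_right_zero LIMSEQ_power_zero) simp
  qed
  ultimately show ?thesis by (rule that)
qed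

section \<open>Orthonormal bases and Parseval's identity\<close>

text \<open>
  The part of the notion of an orthonormal basis that is inherited by subsets and by unions of
  chains, as Bessel's inequality and Zorn's lemma require.
\<close>

definition l2_orthonormal :: "'a measure \<Rightarrow> ('a \<Rightarrow> complex) set \<Rightarrow> bool" where
  "l2_orthonormal M E \<longleftrightarrow> E \<subseteq> L2 M \<and>
     (\<forall>e\<in>E. \<forall>e'\<in>E. l2_inner M e e' = (if e = e' then 1 else 0))"

lemma l2_orthonormal_L2: "l2_orthonormal M E \<Longrightarrow> e \<in> E \<Longrightarrow> e \<in> L2 M"
  by (auto simp: l2_orthonormal_def)

lemma l2_orthonormal_inner:
  "l2_orthonormal M E \<Longrightarrow> e \<in> E \<Longrightarrow> e' \<in> E \<Longrightarrow> l2_inner M e e' = (if e = e' then 1 else 0)"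
  by (auto simp: l2_orthonormal_def)

lemma l2_orthonormal_basis_iff:
  "l2_orthonormal_basis M E \<longleftrightarrow> l2_orthonormal M E \<and>
     (\<forall>f\<in>L2 M. (\<forall>e\<in>E. l2_inner M f e = 0) \<longrightarrow> (AE x in M. f x = 0))"
  by (auto simp: l2_orthonormal_basis_def l2_orthonormal_def)

lemma l2_orthonormal_basisD: "l2_orthonormal_basis M E \<Longrightarrow> l2_orthonormal M E"
  by (simp add: l2_orthonormal_basis_iff)

lemma l2_orthonormal_comb_L2:
  assumes "l2_orthonormal M E" "F \<subseteq> E"
  shows "(\<lambda>x. \<Sum>e\<in>F. c e * e x) \<in> L2 M"
  using assms by (intro L2_sum L2_cmult) (auto dest: l2_orthonormal_L2)

lemma l2_orthonormal_inner_comb: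
  assumes on: "l2_orthonormal M E" and F: "finite F" "F \<subseteq> E" and "e \<in> E"
  shows "l2_inner M (\<lambda>x. \<Sum>e\<in>F. c e * e x) e = (if e \<in> F then c e else 0)"
proof -
  have "l2_inner M (\<lambda>x. \<Sum>e\<in>F. c e * e x) e = (\<Sum>e'\<in>F. c e' * l2_inner M e' e)"
    using assms by (subst l2_inner_sum_left)
      (auto intro!: L2_cmult intro: l2_orthonormal_L2[OF on] simp: l2_inner_cmult_left)
  also have "\<dots> = (\<Sum>e'\<in>F. if e' = e then c e' else 0)"
    using assms by (intro sum.cong) (auto simp: l2_orthonormal_inner[OF on] subset_iff)
  finally show ?thesis using F by simp
qed

lemma l2_Pythagoras:
  assumes on: "l2_orthonormal M E" and F: "finite F" "F \<subseteq> E"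
  shows "(l2_norm M (\<lambda>x. \<Sum>e\<in>F. c e * e x))\<^sup>2 = (\<Sum>e\<in>F. (norm (c e))\<^sup>2)"
proof -
  let ?g = "\<lambda>x. \<Sum>e\<in>F. c e * e x"
  have g: "?g \<in> L2 M" using on F(2) by (rule l2_orthonormal_comb_L2)
  have "complex_of_real ((l2_norm M ?g)\<^sup>2) = (\<Sum>e\<in>F. c e * l2_inner M e ?g)"
    unfolding l2_inner_self[symmetric] using F g
    by (subst l2_inner_sum_left)
      (auto intro!: L2_cmult intro: l2_orthonormal_L2[OF on] simp: l2_inner_cmult_left)
  also have "\<dots> = (\<Sum>e\<in>F. c e * cnj (c e))"
  proof (rule sum.cong[OF refl])
    fix e assume "e \<in> F"
    then have "l2_inner M e ?g = cnj (c e)"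
      using l2_orthonormal_inner_comb[OF on F, of e c] F by (subst cnj_l2_inner[symmetric]) auto
    then show "c e * l2_inner M e ?g = c e * cnj (c e)" by simp
  qed
  also have "\<dots> = complex_of_real (\<Sum>e\<in>F. (norm (c e))\<^sup>2)"
    by (simp add: complex_norm_square del: of_real_power)
  finally show ?thesis by (simp only: of_real_eq_iff)
qed

lemma l2_Bessel_identity:
  assumes on: "l2_orthonormal M E" and F: "finite F" "F \<subseteq> E" and f: "f \<in> L2 M"
  shows "(l2_norm M (\<lambda>x. f x - (\<Sum>e\<in>F. l2_inner M f e * e x)))\<^sup>2 =
    (l2_norm M f)\<^sup>2 - (\<Sum>e\<in>F. (norm (l2_inner M f e))\<^sup>2)"
proof -
  let ?g = "\<lambda>x. \<Sum>e\<in>F. l2_inner M f e * e x"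
  have g: "?g \<in> L2 M" using on F(2) by (rule l2_orthonormal_comb_L2)
  have "l2_inner M ?g f = (\<Sum>e\<in>F. l2_inner M f e * l2_inner M e f)"
    using F f by (subst l2_inner_sum_left)
      (auto intro!: L2_cmult intro: l2_orthonormal_L2[OF on] simp: l2_inner_cmult_left)
  also have "\<dots> = (\<Sum>e\<in>F. l2_inner M f e * cnj (l2_inner M f e))"
    by (simp add: cnj_l2_inner)
  also have "\<dots> = complex_of_real (\<Sum>e\<in>F. (norm (l2_inner M f e))\<^sup>2)"
    by (simp add: complex_norm_square del: of_real_power)
  finally have "l2_inner M f ?g = complex_of_real (\<Sum>e\<in>F. (norm (l2_inner M f e))\<^sup>2)"
    by (subst cnj_l2_inner[symmetric]) (simp only: complex_cnj_complex_of_real)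
  then show ?thesis
    unfolding l2_norm_diff_sq[OF f g] l2_Pythagoras[OF on F] by simp
qed

lemma l2_Bessel_inequality:
  assumes "l2_orthonormal M E" "finite F" "F \<subseteq> E" "f \<in> L2 M"
  shows "(\<Sum>e\<in>F. (norm (l2_inner M f e))\<^sup>2) \<le> (l2_norm M f)\<^sup>2"
  using l2_Bessel_identity[OF assms]
    zero_le_power2[of "l2_norm M (\<lambda>x. f x - (\<Sum>e\<in>F. l2_inner M f e * e x))"] by linarith

text \<open>
  By Zorn's lemma there is a maximal orthonormal set.  A function that is orthogonal to it and not
  almost everywhere zero could be normalised and added to it.
\<close>

lemma l2_orthonormal_basis_exists: "\<exists>E. l2_orthonormal_basis M E"
proof -
  have "\<exists>E\<in>Collect (l2_orthonormal M). \<forall>X\<in>Collect (l2_orthonormal M). E \<subseteq> X \<longrightarrow> X = E"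
  proof (rule subset_Zorn')
    fix C assume C: "subset.chain (Collect (l2_orthonormal M)) C"
    have "l2_inner M e e' = (if e = e' then 1 else 0)" if ee: "e \<in> \<Union>C" "e' \<in> \<Union>C" for e e'
    proof -
      from ee obtain X Y where "X \<in> C" "Y \<in> C" "e \<in> X" "e' \<in> Y" by blast
      moreover from this have "X \<subseteq> Y \<or> Y \<subseteq> X" using C by (auto simp: subset_chain_def)
      ultimately obtain Z where "Z \<in> C" "e \<in> Z" "e' \<in> Z" by blast
      moreover have "l2_orthonormal M Z" using C \<open>Z \<in> C\<close> by (auto simp: subset_chain_def)
      ultimately show ?thesis by (simp add: l2_orthonormal_inner)
    qed
    moreover have "\<Union>C \<subseteq> L2 M"
      using C by (fastforce simp: subset_chain_def l2_orthonormal_def)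
    ultimately show "\<Union>C \<in> Collect (l2_orthonormal M)" by (simp add: l2_orthonormal_def)
  qed
  then obtain E where on: "l2_orthonormal M E"
    and max: "\<And>X. l2_orthonormal M X \<Longrightarrow> E \<subseteq> X \<Longrightarrow> X = E" by auto
  have "AE x in M. f x = 0" if f: "f \<in> L2 M" and orth: "\<And>e. e \<in> E \<Longrightarrow> l2_inner M f e = 0" for f
  proof (rule ccontr)
    assume "\<not> (AE x in M. f x = 0)"
    then have nz: "l2_norm M f \<noteq> 0" by (simp add: l2_norm_eq_0_iff[OF f])
    define c where "c = complex_of_real (1 / l2_norm M f)"
    define u where "u = (\<lambda>x. c * f x)"
    have u: "u \<in> L2 M" unfolding u_def using f by (rule L2_cmult)
    have "norm c = 1 / l2_norm M f" unfolding c_def norm_of_real by simp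
    then have "l2_norm M u = 1" using nz by (simp add: u_def l2_norm_cmult)
    then have uu: "l2_inner M u u = 1" by (simp add: l2_inner_self)
    have ue: "l2_inner M u e = 0" if "e \<in> E" for e
      using orth[OF that] by (simp add: u_def l2_inner_cmult_left)
    have eu: "l2_inner M e u = 0" if "e \<in> E" for e
      using ue[OF that] by (subst cnj_l2_inner[symmetric]) simp
    have "u \<notin> E" using ue uu by force
    moreover have "l2_orthonormal M (insert u E)"
      using on u uu ue eu \<open>u \<notin> E\<close> by (auto simp: l2_orthonormal_def)
    ultimately show False using max[of "insert u E"] by blast
  qed
  with on show ?thesis by (auto simp: l2_orthonormal_basis_iff)
qed

text \<open>
  By Bessel's inequality the squared coefficients are summable.  The partial sums over finite sets
  that exhaust the total fast enough converge in $L^2$ by completeness, and their limit has the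
  same coefficients as $f$: an element outside of all these finite sets has coefficient 0.  Hence
  the limit is $f$ almost everywhere.
\<close>

lemma (in finite_measure) l2_Parseval_norm:
  assumes basis: "l2_orthonormal_basis M E" and f: "f \<in> L2 M"
  shows "((\<lambda>e. (norm (l2_inner M f e))\<^sup>2) has_sum (l2_norm M f)\<^sup>2) E"
proof -
  let ?\<phi> = "\<lambda>e. (norm (l2_inner M f e))\<^sup>2"
  note on = l2_orthonormal_basisD[OF basis]
  define S where "S = infsum ?\<phi> E"
  have "?\<phi> summable_on E"
    by (rule nonneg_bdd_above_summable_on)
      (auto intro!: bdd_aboveI2[where M = "(l2_norm M f)\<^sup>2"] l2_Bessel_inequality[OF on] f)
  then have S: "(?\<phi> has_sum S) E" by (simp add: S_def)
  have "\<exists>F. finite F \<and> F \<subseteq> E \<and> (\<forall>Y. finite Y \<and> F \<subseteq> Y \<and> Y \<subseteq> E \<longrightarrow> dist (sum ?\<phi> Y) S < (1/4) ^ Suc k)" for k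
    using S[unfolded has_sum_def, THEN tendstoD, of "(1/4) ^ Suc k"]
    unfolding eventually_finite_subsets_at_top by simp
  \<comment> \<open>Within \<open>(1/4) ^ Suc k\<close> of the total, two partial sums of squares differ by less than
    \<open>((1/2) ^ k)\<^sup>2\<close>; this is the rate of convergence that \<open>L2_complete\<close> demands of the norms.\<close>
  then obtain G where G: "\<And>k. finite (G k)" "\<And>k. G k \<subseteq> E"
    "\<And>k Y. finite Y \<Longrightarrow> G k \<subseteq> Y \<Longrightarrow> Y \<subseteq> E \<Longrightarrow> dist (sum ?\<phi> Y) S < (1/4) ^ Suc k"
    by metis
  define F where "F k = (\<Union>i\<le>k. G i)" for k
  have F: "finite (F k)" "F k \<subseteq> E" "F k \<subseteq> F (Suc k)" for k
    using G(1,2) by (auto simp: F_def intro: le_SucI)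
  have close: "dist (sum ?\<phi> Y) S < (1/4) ^ Suc k" if "finite Y" "F k \<subseteq> Y" "Y \<subseteq> E" for k Y
    using that by (intro G(3)) (auto simp: F_def)
  have gap: "sum ?\<phi> Y - sum ?\<phi> (F k) \<le> ((1/2) ^ k)\<^sup>2" if "finite Y" "F k \<subseteq> Y" "Y \<subseteq> E" for k Y
  proof -
    have "sum ?\<phi> Y - sum ?\<phi> (F k) \<le> 2 * (1/4) ^ Suc k"
      using close[OF that] close[OF F(1) subset_refl F(2), of k] unfolding dist_real_def by linarith
    also have "\<dots> \<le> (1/4) ^ k" by simp
    also have "\<dots> = ((1/2) ^ k)\<^sup>2"
      unfolding power2_eq_square power_mult_distrib[symmetric] by simp
    finally show ?thesis .
  qed
  define g where "g k = (\<lambda>x. \<Sum>e\<in>F k. l2_inner M f e * e x)" for k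
  have g: "g k \<in> L2 M" for k unfolding g_def using on F(2) by (rule l2_orthonormal_comb_L2)
  have "l2_norm M (\<lambda>x. g (Suc k) x - g k x) \<le> (1/2) ^ k" for k
  proof (rule power2_le_imp_le)
    have "(\<lambda>x. g (Suc k) x - g k x) = (\<lambda>x. \<Sum>e\<in>F (Suc k) - F k. l2_inner M f e * e x)"
      unfolding g_def using F by (simp add: sum_diff)
    then have "(l2_norm M (\<lambda>x. g (Suc k) x - g k x))\<^sup>2 = sum ?\<phi> (F (Suc k) - F k)"
      using F by (simp add: l2_Pythagoras[OF on] Diff_subset[THEN subset_trans])
    also have "\<dots> = sum ?\<phi> (F (Suc k)) - sum ?\<phi> (F k)"
      using F by (simp add: sum_diff)
    also have "\<dots> \<le> ((1/2) ^ k)\<^sup>2" using F by (intro gap)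
    finally show "(l2_norm M (\<lambda>x. g (Suc k) x - g k x))\<^sup>2 \<le> ((1/2) ^ k)\<^sup>2" .
  qed simp
  from L2_complete[OF g this] obtain h where h: "h \<in> L2 M"
    and lim: "(\<lambda>k. l2_norm M (\<lambda>x. g k x - h x)) \<longlonglongrightarrow> 0" .
  have fh: "(\<lambda>x. f x - h x) \<in> L2 M" using f h by (rule L2_diff)
  have half: "(\<lambda>k. (1/2::real) ^ k) \<longlonglongrightarrow> 0" by (rule LIMSEQ_power_zero) simp
  \<comment> \<open>The limit has the same coefficients as \<open>f\<close>, so the basis property identifies the two.\<close>
  have "l2_inner M (\<lambda>x. f x - h x) e = 0" if e: "e \<in> E" for e
  proof -
    have e2: "e \<in> L2 M" using on e by (rule l2_orthonormal_L2)
    have "l2_norm M e = 1"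
      using l2_inner_self[of M e] l2_orthonormal_inner[OF on e e] power2_eq_1_iff[of "l2_norm M e"]
        l2_norm_nonneg[of M e] by (simp del: of_real_power l2_norm_nonneg)
    have "norm (l2_inner M (\<lambda>x. f x - h x) e) \<le> (1/2) ^ k + l2_norm M (\<lambda>x. g k x - h x)" for k
    proof -
      have "norm (l2_inner M f e - l2_inner M (g k) e) \<le> (1/2) ^ k"
      proof (cases "e \<in> F k")
        case True
        then show ?thesis
          using l2_orthonormal_inner_comb[OF on F(1)[of k] F(2)[of k] e, of "l2_inner M f"] by (simp add: g_def)
      next
        case False
        have "?\<phi> e = sum ?\<phi> (insert e (F k)) - sum ?\<phi> (F k)" using False F by simp
        also have "\<dots> \<le> ((1/2) ^ k)\<^sup>2" using F e by (intro gap) auto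
        finally have "norm (l2_inner M f e) \<le> (1/2) ^ k" by (rule power2_le_imp_le) simp
        then show ?thesis
          using l2_orthonormal_inner_comb[OF on F(1)[of k] F(2)[of k] e, of "l2_inner M f"] False by (simp add: g_def)
      qed
      moreover have "norm (l2_inner M (g k) e - l2_inner M h e) \<le> l2_norm M (\<lambda>x. g k x - h x)"
        using l2_Cauchy_Schwarz[OF L2_diff[OF g h] e2, of k] \<open>l2_norm M e = 1\<close>
        by (simp add: l2_inner_diff_left g h e2)
      ultimately show ?thesis
        using norm_triangle_mono[of "l2_inner M f e - l2_inner M (g k) e" _ "l2_inner M (g k) e - l2_inner M h e"]
        by (simp add: l2_inner_diff_left f h e2)
    qed
    moreover have "(\<lambda>k. (1/2) ^ k + l2_norm M (\<lambda>x. g k x - h x)) \<longlonglongrightarrow> 0"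
      using tendsto_add[OF half lim] by simp
    ultimately have "norm (l2_inner M (\<lambda>x. f x - h x) e) \<le> 0"
      by (intro LIMSEQ_le_const) auto
    then show ?thesis by simp
  qed
  then have "AE x in M. f x - h x = 0"
    using basis fh by (auto simp: l2_orthonormal_basis_iff)
  then have AE: "AE x in M. f x - g k x = h x - g k x" for k by eventually_elim simp
  have "l2_norm M (\<lambda>x. g k x - h x) = l2_norm M (\<lambda>x. f x - g k x)" for k
    using AE f h g by (subst l2_norm_minus_commute, intro l2_norm_cong_AE)
      (auto intro!: borel_measurable_diff dest: L2_measurable)
  with lim have "(\<lambda>k. (l2_norm M (\<lambda>x. f x - g k x))\<^sup>2) \<longlonglongrightarrow> 0\<^sup>2"
    by (intro tendsto_power) simp
  then have lim': "(\<lambda>k. (l2_norm M f)\<^sup>2 - sum ?\<phi> (F k)) \<longlonglongrightarrow> 0"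
    unfolding g_def using l2_Bessel_identity[OF on F(1,2) f] by simp
  have "(\<lambda>k. sum ?\<phi> (F k)) \<longlonglongrightarrow> S"
  proof (rule metric_LIMSEQ_I)
    fix r :: real assume "r > 0"
    with LIMSEQ_power_zero[of "1/4::real"] obtain N where N: "\<And>k. k \<ge> N \<Longrightarrow> (1/4) ^ k < r"
      by (auto simp: LIMSEQ_iff)
    have "dist (sum ?\<phi> (F k)) S < r" if "k \<ge> N" for k
      using close[of "F k" k] F N[of "Suc k"] that by force
    then show "\<exists>N. \<forall>k\<ge>N. dist (sum ?\<phi> (F k)) S < r" by blast
  qed
  from tendsto_add[OF lim' this] have "(\<lambda>k. (l2_norm M f)\<^sup>2) \<longlonglongrightarrow> S" by simp
  then have "S = (l2_norm M f)\<^sup>2" by (simp add: LIMSEQ_const_iff)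
  with S show ?thesis by simp
qed

text \<open>
  Convergence along the net of finite subsets, so that uncountable bases are covered.
\<close>

lemma (in finite_measure) l2_basis_expansion:
  assumes basis: "l2_orthonormal_basis M E" and f: "f \<in> L2 M"
  shows "((\<lambda>F. l2_norm M (\<lambda>x. f x - (\<Sum>e\<in>F. l2_inner M f e * e x))) \<longlongrightarrow> 0)
    (finite_subsets_at_top E)"
proof -
  let ?\<phi> = "\<lambda>e. (norm (l2_inner M f e))\<^sup>2"
  have "((\<lambda>F. sqrt ((l2_norm M f)\<^sup>2 - sum ?\<phi> F)) \<longlongrightarrow> sqrt ((l2_norm M f)\<^sup>2 - (l2_norm M f)\<^sup>2))
      (finite_subsets_at_top E)"
    using l2_Parseval_norm[OF assms] unfolding has_sum_def by (intro tendsto_intros)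
  moreover have "\<forall>\<^sub>F F in finite_subsets_at_top E. sqrt ((l2_norm M f)\<^sup>2 - sum ?\<phi> F) =
      l2_norm M (\<lambda>x. f x - (\<Sum>e\<in>F. l2_inner M f e * e x))"
    by (intro eventually_finite_subsets_at_top_weakI)
      (simp flip: l2_Bessel_identity[OF l2_orthonormal_basisD[OF basis] _ _ f])
  ultimately show ?thesis using tendsto_cong by fastforce
qed

lemma (in finite_measure) l2_Parseval_inner:
  assumes basis: "l2_orthonormal_basis M E" and f: "f \<in> L2 M" and g: "g \<in> L2 M"
  shows "((\<lambda>e. l2_inner M f e * l2_inner M e g) has_sum l2_inner M f g) E"
proof -
  note on = l2_orthonormal_basisD[OF basis]
  let ?s = "\<lambda>F. \<Sum>e\<in>F. l2_inner M f e * l2_inner M e g"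
  let ?r = "\<lambda>F. l2_norm M (\<lambda>x. f x - (\<Sum>e\<in>F. l2_inner M f e * e x)) * l2_norm M g"
  have "((\<lambda>F. ?s F - l2_inner M f g) \<longlongrightarrow> 0) (finite_subsets_at_top E)"
  proof (rule Lim_null_comparison)
    show "(?r \<longlongrightarrow> 0) (finite_subsets_at_top E)"
      using tendsto_mult_right[OF l2_basis_expansion[OF basis f], of "l2_norm M g"] by simp
    show "\<forall>\<^sub>F F in finite_subsets_at_top E. norm (?s F - l2_inner M f g) \<le> ?r F"
    proof (intro eventually_finite_subsets_at_top_weakI)
      fix F assume F: "finite F" "F \<subseteq> E"
      have p: "(\<lambda>x. \<Sum>e\<in>F. l2_inner M f e * e x) \<in> L2 M" using on F(2) by (rule l2_orthonormal_comb_L2)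
      have "?s F = l2_inner M (\<lambda>x. \<Sum>e\<in>F. l2_inner M f e * e x) g"
        using F g by (subst l2_inner_sum_left)
          (auto intro!: L2_cmult intro: l2_orthonormal_L2[OF on] simp: l2_inner_cmult_left)
      then show "norm (?s F - l2_inner M f g) \<le> ?r F"
        using l2_Cauchy_Schwarz[OF L2_diff[OF f p] g]
        by (simp add: l2_inner_diff_left f p g norm_minus_commute)
    qed
  qed
  then show ?thesis unfolding has_sum_def by (simp add: LIM_zero_iff)
qed

section \<open>Integral operators with bounded kernels\<close>

text \<open>
  The bound holds everywhere, not just almost everywhere, so that the integral operator is defined
  at every point and is linear without exceptional sets.
\<close>

definition unit_kernel :: "'a measure \<Rightarrow> ('a \<Rightarrow> 'a \<Rightarrow> real) \<Rightarrow> bool" where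
  "unit_kernel M k \<longleftrightarrow> (\<lambda>(x, y). k x y) \<in> borel_measurable (M \<Otimes>\<^sub>M M) \<and> (\<forall>x y. \<bar>k x y\<bar> \<le> 1)"

lemma unit_kernel_measurable:
  assumes "unit_kernel M k" "f \<in> measurable N M" "g \<in> measurable N M"
  shows "(\<lambda>x. k (f x) (g x)) \<in> borel_measurable N"
  using measurable_compose[OF measurable_Pair[OF assms(2,3)], of "\<lambda>(x, y). k x y"] assms(1)
  by (simp add: unit_kernel_def)

lemma unit_kernel_abs_le: "unit_kernel M k \<Longrightarrow> \<bar>k x y\<bar> \<le> 1"
  by (simp add: unit_kernel_def)

lemma unit_kernel_transpose:
  assumes "unit_kernel M k"
  shows "unit_kernel M (\<lambda>x y. k y x)"
  using unit_kernel_measurable[OF assms measurable_snd measurable_fst] unit_kernel_abs_le[OF assms]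
  by (auto simp: unit_kernel_def case_prod_beta)

lemma transition_operator_cong:
  assumes "\<And>x. x \<in> space M \<Longrightarrow> f x = g x"
  shows "transition_operator M k f = transition_operator M k g"
  unfolding transition_operator_def
  by (intro ext Bochner_Integration.integral_cong) (simp_all add: assms)

context finite_measure
begin

interpretation pair: pair_sigma_finite M M ..

lemma transition_operator_measurable:
  assumes k: "unit_kernel M k" and [measurable]: "f \<in> borel_measurable M"
  shows "transition_operator M k f \<in> borel_measurable M"
proof -
  note [measurable] = unit_kernel_measurable[OF k]
  show ?thesis unfolding transition_operator_def by measurable
qed

lemma kernel_mult_integrable:
  assumes k: "unit_kernel M k" and x: "x \<in> space M" and f: "integrable M f"
  shows "integrable M (\<lambda>\<sigma>. complex_of_real (k \<sigma> x) * f \<sigma>)"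
proof (rule Bochner_Integration.integrable_bound[OF f])
  have [measurable]: "(\<lambda>\<sigma>. k \<sigma> x) \<in> borel_measurable M"
    using x by (intro unit_kernel_measurable[OF k]) auto
  note [measurable] = borel_measurable_integrable[OF f]
  show "(\<lambda>\<sigma>. complex_of_real (k \<sigma> x) * f \<sigma>) \<in> borel_measurable M" by measurable
  show "AE \<sigma> in M. norm (complex_of_real (k \<sigma> x) * f \<sigma>) \<le> norm (f \<sigma>)"
    using unit_kernel_abs_le[OF k] by (auto simp: norm_mult mult_left_le_one_le)
qed

lemma transition_operator_le_L1:
  assumes k: "unit_kernel M k" and x: "x \<in> space M" and f: "integrable M f"
  shows "norm (transition_operator M k f x) \<le> (\<integral>\<sigma>. norm (f \<sigma>) \<partial>M)"
proof -
  have "norm (transition_operator M k f x) \<le> (\<integral>\<sigma>. norm (complex_of_real (k \<sigma> x) * f \<sigma>) \<partial>M)"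
    unfolding transition_operator_def by (rule integral_norm_bound)
  also have "\<dots> \<le> (\<integral>\<sigma>. norm (f \<sigma>) \<partial>M)"
    using unit_kernel_abs_le[OF k]
    by (intro integral_mono integrable_norm kernel_mult_integrable assms)
      (auto simp: norm_mult mult_left_le_one_le)
  finally show ?thesis .
qed

lemma transition_operator_L2:
  assumes k: "unit_kernel M k" and f: "f \<in> L2 M"
  shows "transition_operator M k f \<in> L2 M"
  using transition_operator_le_L1[OF k _ L2_imp_integrable[OF f]]
  by (rule L2_bounded[rotated]) (simp_all add: transition_operator_measurable[OF k L2_measurable[OF f]])

lemma transition_operator_norm_le:
  assumes k: "unit_kernel M k" and f: "f \<in> L2 M"
  shows "l2_norm M (transition_operator M k f) \<le> measure M (space M) * l2_norm M f"
proof (rule power2_le_imp_le)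
  let ?c = "l2_norm M f * sqrt (measure M (space M))"
  have "norm (transition_operator M k f x) \<le> ?c" if "x \<in> space M" for x
    using transition_operator_le_L1[OF k that L2_imp_integrable[OF f]] L1_norm_le_l2_norm[OF f]
    by linarith
  then have "(\<integral>x. (norm (transition_operator M k f x))\<^sup>2 \<partial>M) \<le> (\<integral>x. ?c\<^sup>2 \<partial>M)"
    by (intro integral_mono L2_integrable transition_operator_L2 assms) (auto intro!: power_mono)
  also have "\<dots> = (measure M (space M) * l2_norm M f)\<^sup>2"
    by (simp add: power_mult_distrib power2_eq_square)
  finally show "(l2_norm M (transition_operator M k f))\<^sup>2 \<le> (measure M (space M) * l2_norm M f)\<^sup>2"
    by (simp add: l2_norm_sq)
qed simp

lemma transition_operator_linear:
  assumes k: "unit_kernel M k" and f: "f \<in> L2 M" and g: "g \<in> L2 M" and x: "x \<in> space M"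
  shows "transition_operator M k (\<lambda>y. a * f y + b * g y) x =
    a * transition_operator M k f x + b * transition_operator M k g x"
proof -
  have i: "integrable M (\<lambda>\<sigma>. complex_of_real (k \<sigma> x) * f \<sigma>)"
    "integrable M (\<lambda>\<sigma>. complex_of_real (k \<sigma> x) * g \<sigma>)"
    by (intro kernel_mult_integrable k x L2_imp_integrable f g)+
  have "transition_operator M k (\<lambda>y. a * f y + b * g y) x =
      (\<integral>\<sigma>. a * (complex_of_real (k \<sigma> x) * f \<sigma>) + b * (complex_of_real (k \<sigma> x) * g \<sigma>) \<partial>M)"
    unfolding transition_operator_def by (simp add: algebra_simps)
  also have "\<dots> = a * transition_operator M k f x + b * transition_operator M k g x"
    unfolding transition_operator_def using i
    by (subst Bochner_Integration.integral_add) auto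
  finally show ?thesis .
qed

lemma l2_operator_transition: "unit_kernel M k \<Longrightarrow> l2_operator M (transition_operator M k)"
  unfolding l2_operator_def
  using transition_operator_L2 transition_operator_linear transition_operator_norm_le by blast

lemma kernel_product_integrable:
  assumes k: "unit_kernel M k" and f: "f \<in> L2 M" and g: "g \<in> L2 M"
  shows "integrable (M \<Otimes>\<^sub>M M) (\<lambda>(\<sigma>, x). complex_of_real (k \<sigma> x) * f \<sigma> * g x)"
proof (rule Bochner_Integration.integrable_bound)
  note [measurable] = unit_kernel_measurable[OF k] f[THEN L2_measurable] g[THEN L2_measurable]
  have fi: "integrable M f" and gi: "integrable M g" using f g by (simp_all add: L2_imp_integrable)
  show "integrable (M \<Otimes>\<^sub>M M) (\<lambda>(\<sigma>, x). f \<sigma> * g x)"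
    by (rule pair.Fubini_integrable) (use fi gi in \<open>auto simp: norm_mult\<close>)
  show "(\<lambda>(\<sigma>, x). complex_of_real (k \<sigma> x) * f \<sigma> * g x) \<in> borel_measurable (M \<Otimes>\<^sub>M M)"
    by measurable
  show "AE p in M \<Otimes>\<^sub>M M. norm (case p of (\<sigma>, x) \<Rightarrow> complex_of_real (k \<sigma> x) * f \<sigma> * g x)
      \<le> norm (case p of (\<sigma>, x) \<Rightarrow> f \<sigma> * g x)"
    using unit_kernel_abs_le[OF k] by (auto simp: norm_mult mult.assoc mult_left_le_one_le)
qed

text \<open>
  Stated for the bilinear pairing because it is also used for integrals along paths; the
  sesquilinear version follows, the kernel being real.
\<close>

lemma transition_operator_transpose:
  assumes k: "unit_kernel M k" and f: "f \<in> L2 M" and g: "g \<in> L2 M"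
  shows "(\<integral>x. transition_operator M k f x * g x \<partial>M) =
    (\<integral>x. f x * transition_operator M (\<lambda>x y. k y x) g x \<partial>M)"
proof -
  have "(\<integral>x. transition_operator M k f x * g x \<partial>M) =
      (\<integral>x. (\<integral>\<sigma>. complex_of_real (k \<sigma> x) * f \<sigma> * g x \<partial>M) \<partial>M)"
    by (simp add: transition_operator_def)
  also have "\<dots> = (\<integral>\<sigma>. (\<integral>x. complex_of_real (k \<sigma> x) * f \<sigma> * g x \<partial>M) \<partial>M)"
    by (rule pair.Fubini_integral[OF kernel_product_integrable[OF assms]])
  also have "\<dots> = (\<integral>\<sigma>. f \<sigma> * transition_operator M (\<lambda>x y. k y x) g \<sigma> \<partial>M)"
    unfolding transition_operator_def
    by (subst Bochner_Integration.integral_mult_right_zero[symmetric]) (simp add: mult_ac)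
  finally show ?thesis .
qed

lemma transition_operator_cnj:
  "transition_operator M k (\<lambda>x. cnj (f x)) = (\<lambda>x. cnj (transition_operator M k f x))"
  unfolding transition_operator_def Bochner_Integration.integral_cnj[symmetric] by simp

lemma transition_operator_adjoint:
  assumes "unit_kernel M k" "f \<in> L2 M" "g \<in> L2 M"
  shows "l2_inner M (transition_operator M k f) g =
    l2_inner M f (transition_operator M (\<lambda>x y. k y x) g)"
  unfolding l2_inner_def
  using transition_operator_transpose[OF assms(1,2) L2_cnj[OF assms(3)]]
  by (simp only: transition_operator_cnj)

lemma transition_operator_power_L2:
  assumes k: "unit_kernel M k" and f: "f \<in> L2 M"
  shows "(transition_operator M k ^^ m) f \<in> L2 M"
  using f by (induction m) (auto intro: transition_operator_L2[OF k])

lemma transition_operator_power_adjoint: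
  assumes k: "unit_kernel M k" and f: "f \<in> L2 M" and g: "g \<in> L2 M"
  shows "l2_inner M ((transition_operator M k ^^ m) f) g =
    l2_inner M f ((transition_operator M (\<lambda>x y. k y x) ^^ m) g)"
  using g
proof (induction m arbitrary: g)
  case (Suc m)
  have "l2_inner M ((transition_operator M k ^^ Suc m) f) g =
      l2_inner M ((transition_operator M k ^^ m) f) (transition_operator M (\<lambda>x y. k y x) g)"
    using transition_operator_adjoint[OF k transition_operator_power_L2[OF k f] Suc.prems, of m] by simp
  also have "\<dots> = l2_inner M f ((transition_operator M (\<lambda>x y. k y x) ^^ Suc m) g)"
    using Suc.IH[OF transition_operator_L2[OF unit_kernel_transpose[OF k] Suc.prems]]
    by (simp only: funpow_Suc_right comp_apply)
  finally show ?case .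
qed simp

lemma transition_operator_power_norm_le:
  assumes k: "unit_kernel M k" and f: "f \<in> L2 M"
  shows "l2_norm M ((transition_operator M k ^^ m) f) \<le> measure M (space M) ^ m * l2_norm M f"
proof (induction m)
  case (Suc m)
  have "l2_norm M ((transition_operator M k ^^ Suc m) f) \<le>
      measure M (space M) * l2_norm M ((transition_operator M k ^^ m) f)"
    using transition_operator_norm_le[OF k transition_operator_power_L2[OF k f]] by simp
  also have "\<dots> \<le> measure M (space M) * (measure M (space M) ^ m * l2_norm M f)"
    by (intro mult_left_mono Suc.IH) simp
  finally show ?case by (simp add: mult.assoc)
qed simp

lemma l2_operator_transition_power:
  assumes k: "unit_kernel M k"
  shows "l2_operator M (transition_operator M k ^^ m)"
proof -
  have lin: "\<forall>x\<in>space M. (transition_operator M k ^^ m) (\<lambda>y. a * f y + b * g y) x =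
      a * (transition_operator M k ^^ m) f x + b * (transition_operator M k ^^ m) g x"
    if f: "f \<in> L2 M" and g: "g \<in> L2 M" for f g a b
  proof (induction m)
    case (Suc m)
    let ?T = "transition_operator M k"
    have "?T ((?T ^^ m) (\<lambda>y. a * f y + b * g y)) = ?T (\<lambda>y. a * (?T ^^ m) f y + b * (?T ^^ m) g y)"
      using Suc.IH by (intro transition_operator_cong) auto
    then show ?case
      using transition_operator_linear[OF k transition_operator_power_L2[OF k f]
          transition_operator_power_L2[OF k g]] by simp
  qed simp
  show ?thesis
    unfolding l2_operator_def
    using transition_operator_power_L2[OF k] lin transition_operator_power_norm_le[OF k]
    by blast
qed

text \<open>
  The value of the image of $e$ at $x$ is the inner product of $e$ with the kernel function at
  $x$.  Bessel's inequality bounds the sum for each $x$, and integration over $x$ gives the claim.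
\<close>

lemma transition_operator_Hilbert_Schmidt:
  assumes k: "unit_kernel M k" and on: "l2_orthonormal M E" and F: "finite F" "F \<subseteq> E"
  shows "(\<Sum>e\<in>F. (l2_norm M (transition_operator M k e))\<^sup>2) \<le>
    (\<integral>p. (k (fst p) (snd p))\<^sup>2 \<partial>(M \<Otimes>\<^sub>M M))"
proof -
  interpret P: finite_measure "M \<Otimes>\<^sub>M M"
    by (intro finite_measure_pair_measure finite_measure_axioms)
  note [measurable] = unit_kernel_measurable[OF k]
  have e: "e \<in> L2 M" if "e \<in> F" for e using that F on by (auto intro: l2_orthonormal_L2)
  have int: "integrable (M \<Otimes>\<^sub>M M) (\<lambda>(\<sigma>, x). (k \<sigma> x)\<^sup>2)"
    using unit_kernel_abs_le[OF k]
    by (intro P.integrable_const_bound[where B = 1]) (auto simp: abs_square_le_1)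
  have pointwise: "(\<Sum>e\<in>F. (norm (transition_operator M k e x))\<^sup>2) \<le> (\<integral>\<sigma>. (k \<sigma> x)\<^sup>2 \<partial>M)"
    if x: "x \<in> space M" for x
  proof -
    let ?k = "\<lambda>\<sigma>. complex_of_real (k \<sigma> x)"
    have [measurable]: "(\<lambda>\<sigma>. k \<sigma> x) \<in> borel_measurable M"
      using x by (intro unit_kernel_measurable[OF k]) auto
    have kx: "?k \<in> L2 M"
      using unit_kernel_abs_le[OF k] by (intro L2_bounded[of _ 1]) auto
    have "transition_operator M k e x = l2_inner M e ?k" for e
      by (simp add: transition_operator_def l2_inner_def mult.commute)
    then have "(\<Sum>e\<in>F. (norm (transition_operator M k e x))\<^sup>2) = (\<Sum>e\<in>F. (norm (l2_inner M ?k e))\<^sup>2)"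
      by (simp add: norm_l2_inner_commute[of M _ ?k])
    also have "\<dots> \<le> (l2_norm M ?k)\<^sup>2"
      by (rule l2_Bessel_inequality[OF on F kx])
    finally show ?thesis by (simp add: l2_norm_sq)
  qed
  have "(\<Sum>e\<in>F. (l2_norm M (transition_operator M k e))\<^sup>2) =
      (\<integral>x. (\<Sum>e\<in>F. (norm (transition_operator M k e x))\<^sup>2) \<partial>M)"
    unfolding l2_norm_sq
    by (intro Bochner_Integration.integral_sum[symmetric] L2_integrable transition_operator_L2 k e)
  also have "\<dots> \<le> (\<integral>x. (\<integral>\<sigma>. (k \<sigma> x)\<^sup>2 \<partial>M) \<partial>M)"
    by (intro integral_mono Bochner_Integration.integrable_sum L2_integrable transition_operator_L2
        k e pointwise pair.integrable_snd int)
  also have "\<dots> = (\<integral>p. (k (fst p) (snd p))\<^sup>2 \<partial>(M \<Otimes>\<^sub>M M))"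
    using pair.integral_snd[OF int] by (simp add: split_beta')
  finally show ?thesis .
qed

end

section \<open>Products of Hilbert--Schmidt operators are trace class\<close>

lemma l2_operator_L2: "l2_operator M T \<Longrightarrow> f \<in> L2 M \<Longrightarrow> T f \<in> L2 M"
  by (simp add: l2_operator_def)

lemma l2_operator_linear:
  "l2_operator M T \<Longrightarrow> f \<in> L2 M \<Longrightarrow> g \<in> L2 M \<Longrightarrow>
    AE x in M. T (\<lambda>y. a * f y + b * g y) x = a * T f x + b * T g x"
  by (simp add: l2_operator_def)

lemma l2_operator_sum:
  assumes T: "l2_operator M T" and F: "finite F" "F \<subseteq> L2 M"
  shows "AE x in M. T (\<lambda>y. \<Sum>e\<in>F. c e * e y) x = (\<Sum>e\<in>F. c e * T e x)"
  using F
proof (induction F)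
  case empty
  show ?case using l2_operator_linear[OF T L2_zero L2_zero, of 0 0] by simp
next
  case (insert e F)
  have "(\<lambda>y. \<Sum>e\<in>F. c e * e y) \<in> L2 M" using insert.prems by (intro L2_sum L2_cmult) auto
  then have "AE x in M. T (\<lambda>y. c e * e y + 1 * (\<Sum>e\<in>F. c e * e y)) x =
      c e * T e x + 1 * T (\<lambda>y. \<Sum>e\<in>F. c e * e y) x"
    using insert.prems by (intro l2_operator_linear[OF T]) auto
  with insert.IH insert.prems show ?case using insert.hyps by auto
qed

text \<open>
  Sequences indexed by natural numbers have to represent sums over a countable set that may be
  finite; indices outside the range of the enumeration contribute 0.
\<close>

lemma sum_enumeration:
  fixes \<phi> :: "'a \<Rightarrow> 'b::comm_monoid_add"
  assumes "countable X"
  shows "(\<Sum>k<N. if k \<in> to_nat_on X ` X then \<phi> (from_nat_into X k) else 0) =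
    (\<Sum>e\<in>{e \<in> X. to_nat_on X e < N}. \<phi> e)"
proof -
  have "(\<Sum>k<N. if k \<in> to_nat_on X ` X then \<phi> (from_nat_into X k) else 0) =
      (\<Sum>k\<in>{k \<in> {..<N}. k \<in> to_nat_on X ` X}. \<phi> (from_nat_into X k))"
    by (rule sum.inter_filter[symmetric]) simp
  also have "\<dots> = (\<Sum>e\<in>{e \<in> X. to_nat_on X e < N}. \<phi> e)"
    using assms
    by (intro sum.reindex_bij_witness[of _ "to_nat_on X" "from_nat_into X"]) auto
  finally show ?thesis .
qed

lemma sum_mult_le_sqrt:
  fixes a b :: "'a \<Rightarrow> real"
  assumes "(\<Sum>i\<in>F. (a i)\<^sup>2) \<le> A" "(\<Sum>i\<in>F. (b i)\<^sup>2) \<le> B"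
  shows "(\<Sum>i\<in>F. \<bar>a i\<bar> * \<bar>b i\<bar>) \<le> sqrt A * sqrt B"
proof -
  have "(\<Sum>i\<in>F. \<bar>a i\<bar> * \<bar>b i\<bar>) \<le> L2_set a F * L2_set b F" by (rule L2_set_mult_ineq)
  also have "\<dots> \<le> sqrt A * sqrt B"
  proof (rule mult_mono)
    have "0 \<le> A" by (rule order_trans[OF sum_nonneg assms(1)]) simp
    then show "0 \<le> sqrt A" by simp
    show "L2_set a F \<le> sqrt A" "L2_set b F \<le> sqrt B"
      unfolding L2_set_def using assms by (simp_all only: real_sqrt_le_iff)
  qed (rule L2_set_nonneg)
  finally show ?thesis .
qed

text \<open>
  Expanding $Hf$ in the basis gives $T(Hf) = \sum_e \langle f, Le\rangle\, Te$, where $L$ is the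
  adjoint of $H$.  Square-summability of $\|Te\|$ leaves only countably many relevant $e$, which
  are enumerated to obtain a sequence, and together with square-summability of $\|Le\|$ it makes
  the representation nuclear.
\<close>

lemma (in finite_measure) l2_trace_class_comp:
  assumes basis: "l2_orthonormal_basis M E"
    and T: "l2_operator M T" and H: "l2_operator M H" and TH: "l2_operator M (\<lambda>f. T (H f))"
    and L: "\<And>g. g \<in> L2 M \<Longrightarrow> L g \<in> L2 M"
    and adj: "\<And>f g. f \<in> L2 M \<Longrightarrow> g \<in> L2 M \<Longrightarrow> l2_inner M (H f) g = l2_inner M f (L g)"
    and HS_T: "\<And>F. finite F \<Longrightarrow> F \<subseteq> E \<Longrightarrow> (\<Sum>e\<in>F. (l2_norm M (T e))\<^sup>2) \<le> a"
    and HS_L: "\<And>F. finite F \<Longrightarrow> F \<subseteq> E \<Longrightarrow> (\<Sum>e\<in>F. (l2_norm M (L e))\<^sup>2) \<le> b"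
  shows "l2_trace_class M (\<lambda>f. T (H f))"
proof -
  note on = l2_orthonormal_basisD[OF basis]
  note E = l2_orthonormal_L2[OF on]
  define E0 where "E0 = {e \<in> E. (l2_norm M (T e))\<^sup>2 \<noteq> 0}"
  have "(\<lambda>e. (l2_norm M (T e))\<^sup>2) summable_on E"
    by (rule nonneg_bdd_above_summable_on) (auto intro!: bdd_aboveI2[where M = a] HS_T)
  then have c: "countable E0" unfolding E0_def by (rule summable_countable_real)
  have E0: "E0 \<subseteq> E" by (auto simp: E0_def)
  define G where "G N = {e \<in> E0. to_nat_on E0 e < N}" for N
  have G: "finite (G N)" "G N \<subseteq> E0" for N
  proof -
    have "inj_on (to_nat_on E0) (G N)"
      using inj_on_to_nat_on[OF c] by (rule inj_on_subset) (auto simp: G_def)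
    moreover have "to_nat_on E0 ` G N \<subseteq> {..<N}" by (auto simp: G_def)
    ultimately show "finite (G N)" using finite_imageD finite_subset by blast
  qed (auto simp: G_def)
  define I where "I = to_nat_on E0 ` E0"
  define e where "e = from_nat_into E0"
  have e_in: "e k \<in> E0" if "k \<in> I" for k
    using that c by (auto simp: I_def e_def)
  define u where "u k = (if k \<in> I then L (e k) else (\<lambda>_. 0))" for k
  define v where "v k = (if k \<in> I then T (e k) else (\<lambda>_. 0))" for k
  have "u k \<in> L2 M \<and> v k \<in> L2 M" for k
    using e_in E0 by (auto simp: u_def v_def intro!: L l2_operator_L2[OF T] intro: E)
  moreover have "summable (\<lambda>k. l2_norm M (u k) * l2_norm M (v k))"
  proof (rule summableI_nonneg_bounded)
    fix N
    have "(\<Sum>k<N. l2_norm M (u k) * l2_norm M (v k)) =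
        (\<Sum>k<N. if k \<in> I then l2_norm M (T (e k)) * l2_norm M (L (e k)) else 0)"
      by (intro sum.cong) (auto simp: u_def v_def l2_norm_def)
    also have "\<dots> = (\<Sum>e\<in>G N. l2_norm M (T e) * l2_norm M (L e))"
      unfolding I_def e_def G_def by (rule sum_enumeration[OF c])
    also have "\<dots> = (\<Sum>e\<in>G N. \<bar>l2_norm M (T e)\<bar> * \<bar>l2_norm M (L e)\<bar>)" by simp
    also have "\<dots> \<le> sqrt a * sqrt b"
      using G E0 by (intro sum_mult_le_sqrt HS_T HS_L) auto
    finally show "(\<Sum>k<N. l2_norm M (u k) * l2_norm M (v k)) \<le> sqrt a * sqrt b" .
  qed simp
  moreover have "(\<lambda>N. l2_norm M (\<lambda>x. T (H f) x - (\<Sum>k<N. l2_inner M f (u k) * v k x))) \<longlonglongrightarrow> 0"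
    if f: "f \<in> L2 M" for f
  proof -
    from T obtain C where C: "\<And>f. f \<in> L2 M \<Longrightarrow> l2_norm M (T f) \<le> C * l2_norm M f"
      unfolding l2_operator_def by blast
    have Hf: "H f \<in> L2 M" using H f by (rule l2_operator_L2)
    define R where "R F = (\<lambda>x. T (H f) x - (\<Sum>e\<in>F. l2_inner M f (L e) * T e x))" for F
    define P where "P F = (\<lambda>x. \<Sum>e\<in>F. l2_inner M (H f) e * e x)" for F
    have P: "P F \<in> L2 M" if "F \<subseteq> E" for F
      unfolding P_def using on that by (rule l2_orthonormal_comb_L2)
    have RL2: "R F \<in> L2 M" if "F \<subseteq> E" for F
      unfolding R_def using that
      by (intro L2_diff L2_sum L2_cmult l2_operator_L2[OF T] Hf) (auto intro: E)
    have Rle: "l2_norm M (R F) \<le> C * l2_norm M (\<lambda>x. H f x - P F x)" if F: "finite F" "F \<subseteq> E" for F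
    proof -
      have "AE x in M. T (\<lambda>y. 1 * H f y + (-1) * P F y) x = 1 * T (H f) x + (-1) * T (P F) x"
        by (intro l2_operator_linear[OF T] Hf P F)
      moreover have "AE x in M. T (P F) x = (\<Sum>e\<in>F. l2_inner M (H f) e * T e x)"
        unfolding P_def using F E by (intro l2_operator_sum[OF T]) auto
      ultimately have "AE x in M. R F x = T (\<lambda>y. H f y - P F y) x"
      proof eventually_elim
        case (elim x)
        have "(\<Sum>e\<in>F. l2_inner M f (L e) * T e x) = (\<Sum>e\<in>F. l2_inner M (H f) e * T e x)"
          using F E adj[OF f] by (intro sum.cong) auto
        with elim show ?case by (simp add: R_def)
      qed
      then have "l2_norm M (R F) = l2_norm M (T (\<lambda>y. H f y - P F y))"
        using RL2[OF F(2)] l2_operator_L2[OF T L2_diff[OF Hf P[OF F(2)]]]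
        by (intro l2_norm_cong_AE) (auto dest: L2_measurable)
      also have "\<dots> \<le> C * l2_norm M (\<lambda>x. H f x - P F x)"
        by (intro C L2_diff Hf P F)
      finally show ?thesis .
    qed
    \<comment> \<open>The remainder vanishes along the net of all finite subsets of the basis; it remains to pass to
      the sets \<open>G N\<close>.\<close>
    have "((\<lambda>F. l2_norm M (R F)) \<longlongrightarrow> 0) (finite_subsets_at_top E)"
    proof (rule Lim_null_comparison)
      show "((\<lambda>F. C * l2_norm M (\<lambda>x. H f x - P F x)) \<longlongrightarrow> 0) (finite_subsets_at_top E)"
        using tendsto_mult_left[OF l2_basis_expansion[OF basis Hf], of C] by (simp add: P_def)
      show "\<forall>\<^sub>F F in finite_subsets_at_top E. norm (l2_norm M (R F)) \<le> C * l2_norm M (\<lambda>x. H f x - P F x)"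
        using Rle by (intro eventually_finite_subsets_at_top_weakI) auto
    qed
    note lim = this
    have "(\<lambda>N. l2_norm M (R (G N))) \<longlonglongrightarrow> 0"
    proof (rule LIMSEQ_I)
      fix r :: real assume "r > 0"
      then have "\<forall>\<^sub>F F in finite_subsets_at_top E. dist (l2_norm M (R F)) 0 < r"
        using lim by (rule tendstoD[rotated])
      then obtain X where X: "finite X" "X \<subseteq> E"
        and small: "\<And>Y. finite Y \<Longrightarrow> X \<subseteq> Y \<Longrightarrow> Y \<subseteq> E \<Longrightarrow> l2_norm M (R Y) < r"
        unfolding eventually_finite_subsets_at_top by (auto simp: dist_real_def)
      obtain N where N: "\<And>e. e \<in> X \<Longrightarrow> to_nat_on E0 e < N"
        using finite_nat_set_iff_bounded[of "to_nat_on E0 ` X"] X by auto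
      have "l2_norm M (R (G n)) < r" if n: "n \<ge> N" for n
      proof -
        \<comment> \<open>Outside \<open>E0\<close> the images under \<open>T\<close> are null functions, so that \<open>G n\<close> may be enlarged by
          finitely many such elements.\<close>
        have XG: "X \<inter> E0 \<subseteq> G n" using N n by (fastforce simp: G_def)
        have "AE x in M. \<forall>e\<in>X - E0. T e x = 0"
        proof (intro AE_finite_allI)
          fix e assume "e \<in> X - E0"
          then have "l2_norm M (T e) = 0" "e \<in> E" using X by (auto simp: E0_def)
          then show "AE x in M. T e x = 0"
            using l2_norm_eq_0_iff[OF l2_operator_L2[OF T E]] by blast
        qed (use X in auto)
        then have "AE x in M. R (G n) x = R (G n \<union> X) x"
        proof eventually_elim
          case (elim x)
          have "(\<Sum>e\<in>G n \<union> X. l2_inner M f (L e) * T e x) = (\<Sum>e\<in>G n. l2_inner M f (L e) * T e x)"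
            using elim XG G X by (intro sum.mono_neutral_right) auto
          then show ?case by (simp add: R_def)
        qed
        then have "l2_norm M (R (G n)) = l2_norm M (R (G n \<union> X))"
          using RL2[of "G n"] RL2[of "G n \<union> X"] G E0 X
          by (intro l2_norm_cong_AE) (auto intro!: L2_measurable)
        also have "\<dots> < r" using G E0 X by (intro small) auto
        finally show ?thesis .
      qed
      then show "\<exists>no. \<forall>n\<ge>no. norm (l2_norm M (R (G n)) - 0) < r" by auto
    qed
    moreover have "R (G N) = (\<lambda>x. T (H f) x - (\<Sum>k<N. l2_inner M f (u k) * v k x))" for N
    proof
      fix x
      have "(\<Sum>k<N. l2_inner M f (u k) * v k x) =
          (\<Sum>k<N. if k \<in> I then l2_inner M f (L (e k)) * T (e k) x else 0)"
        by (intro sum.cong) (auto simp: u_def v_def)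
      also have "\<dots> = (\<Sum>e\<in>G N. l2_inner M f (L e) * T e x)"
        unfolding I_def e_def G_def by (rule sum_enumeration[OF c])
      finally show "R (G N) x = T (H f) x - (\<Sum>k<N. l2_inner M f (u k) * v k x)"
        by (simp add: R_def)
    qed
    ultimately show ?thesis by simp
  qed
  ultimately show ?thesis
    unfolding l2_trace_class_def using TH by blast
qed

section \<open>Trace pairings and path integrals\<close>

context finite_measure
begin

text \<open>
  A $\pi$-$\lambda$ argument in the set $S$.  On rectangles the kernel has rank one and Parseval's
  identity applies.  Complements follow from additivity, and disjoint unions from the bound of the
  pairing by a constant times the square root of the measure of $S$, which makes the remainder
  terms vanish in the limit.
\<close>

lemma pairing_has_sum_measure:
  assumes basis: "l2_orthonormal_basis M E"
    and H: "\<And>f. f \<in> L2 M \<Longrightarrow> H f \<in> L2 M" and L: "\<And>g. g \<in> L2 M \<Longrightarrow> L g \<in> L2 M"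
    and adj: "\<And>f g. f \<in> L2 M \<Longrightarrow> g \<in> L2 M \<Longrightarrow> l2_inner M (H f) g = l2_inner M f (L g)"
    and HS_L: "\<And>F. finite F \<Longrightarrow> F \<subseteq> E \<Longrightarrow> (\<Sum>e\<in>F. (l2_norm M (L e))\<^sup>2) \<le> b"
    and N: "finite_measure N" "sets N = sets (M \<Otimes>\<^sub>M M)"
    and rect: "\<And>B C. B \<in> sets M \<Longrightarrow> C \<in> sets M \<Longrightarrow>
      l2_inner M (H (\<lambda>x. complex_of_real (indicator C x))) (\<lambda>x. complex_of_real (indicator B x)) =
        complex_of_real (measure N (B \<times> C))"
    and S: "S \<in> sets (M \<Otimes>\<^sub>M M)"
  shows "((\<lambda>e. l2_inner M (transition_operator M (\<lambda>\<sigma> x. indicator S (\<sigma>, x)) e) (L e))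
    has_sum complex_of_real (measure N S)) E"
proof -
  interpret P: finite_measure "M \<Otimes>\<^sub>M M"
    by (intro finite_measure_pair_measure finite_measure_axioms)
  interpret N: finite_measure N by (rule N)
  note on = l2_orthonormal_basisD[OF basis]
  note E = l2_orthonormal_L2[OF on]
  define T where "T S = transition_operator M (\<lambda>\<sigma> x. indicat_real S (\<sigma>, x))" for S
  define a where "a S e = l2_inner M (T S e) (L e)" for S e
  define s where "s S = infsum (a S) E" for S
  have kernel: "unit_kernel M (\<lambda>\<sigma> x. indicat_real S (\<sigma>, x))" if "S \<in> sets (M \<Otimes>\<^sub>M M)" for S
    using borel_measurable_indicator[OF that]
    by (simp add: unit_kernel_def split_beta' indicator_le_1)
  have bound: "(\<Sum>e\<in>F. norm (a S e)) \<le> sqrt (measure (M \<Otimes>\<^sub>M M) S) * sqrt b"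
    if S: "S \<in> sets (M \<Otimes>\<^sub>M M)" and F: "finite F" "F \<subseteq> E" for S F
  proof -
    have "(\<Sum>e\<in>F. norm (a S e)) \<le> (\<Sum>e\<in>F. \<bar>l2_norm M (T S e)\<bar> * \<bar>l2_norm M (L e)\<bar>)"
      unfolding a_def T_def using F
      by (intro sum_mono order_trans[OF l2_Cauchy_Schwarz] transition_operator_L2 kernel S L)
        (auto intro: E)
    also have "\<dots> \<le> sqrt (measure (M \<Otimes>\<^sub>M M) S) * sqrt b"
    proof (intro sum_mult_le_sqrt HS_L F)
      have "(\<integral>p. (indicat_real S (fst p, snd p))\<^sup>2 \<partial>(M \<Otimes>\<^sub>M M)) = (\<integral>p. indicat_real S p \<partial>(M \<Otimes>\<^sub>M M))"
        by (intro Bochner_Integration.integral_cong) (auto simp: indicator_def)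
      also have "\<dots> = measure (M \<Otimes>\<^sub>M M) S" using S by simp
      finally show "(\<Sum>e\<in>F. (l2_norm M (T S e))\<^sup>2) \<le> measure (M \<Otimes>\<^sub>M M) S"
        unfolding T_def using transition_operator_Hilbert_Schmidt[OF kernel[OF S] on F] by simp
    qed
    finally show ?thesis .
  qed
  have summable: "(\<lambda>e. norm (a S e)) summable_on E" if "S \<in> sets (M \<Otimes>\<^sub>M M)" for S
    by (rule nonneg_bdd_above_summable_on)
      (auto intro!: bdd_aboveI2[where M = "sqrt (measure (M \<Otimes>\<^sub>M M) S) * sqrt b"] bound that)
  then have has_sum: "(a S has_sum s S) E" if "S \<in> sets (M \<Otimes>\<^sub>M M)" for S
    using that by (simp add: s_def abs_summable_summable)
  have small: "norm (s S) \<le> sqrt (measure (M \<Otimes>\<^sub>M M) S) * sqrt b" if S: "S \<in> sets (M \<Otimes>\<^sub>M M)" for S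
  proof -
    have "norm (s S) \<le> (\<Sum>\<^sub>\<infinity>e\<in>E. norm (a S e))"
      unfolding s_def using summable[OF S] by (rule norm_infsum_bound)
    also have "\<dots> \<le> sqrt (measure (M \<Otimes>\<^sub>M M) S) * sqrt b"
      using summable[OF S] bound[OF S] by (rule infsum_le_finite_sums)
    finally show ?thesis .
  qed
  have add: "s (S \<union> S') = s S + s S'"
    if S: "S \<in> sets (M \<Otimes>\<^sub>M M)" "S' \<in> sets (M \<Otimes>\<^sub>M M)" "S \<inter> S' = {}" for S S'
  proof -
    have "a (S \<union> S') e = a S e + a S' e" if e: "e \<in> E" for e
    proof -
      have int: "integrable M (\<lambda>\<sigma>. complex_of_real (indicat_real X (\<sigma>, x)) * e \<sigma>)"
        if "x \<in> space M" "X \<in> sets (M \<Otimes>\<^sub>M M)" for x X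
        using that by (intro kernel_mult_integrable[of "\<lambda>\<sigma> x. indicat_real X (\<sigma>, x)"]
            kernel L2_imp_integrable E e)
      have "T (S \<union> S') e x = T S e x + T S' e x" if x: "x \<in> space M" for x
      proof -
        have "T (S \<union> S') e x = (\<integral>\<sigma>. complex_of_real (indicat_real S (\<sigma>, x)) * e \<sigma> +
            complex_of_real (indicat_real S' (\<sigma>, x)) * e \<sigma> \<partial>M)"
          unfolding T_def transition_operator_def using S(3)
          by (intro Bochner_Integration.integral_cong)
            (auto simp: indicator_def disjoint_iff)
        also have "\<dots> = T S e x + T S' e x"
          unfolding T_def transition_operator_def using x S
          by (intro Bochner_Integration.integral_add int)
        finally show ?thesis .
      qed
      then have "a (S \<union> S') e = l2_inner M (\<lambda>x. T S e x + T S' e x) (L e)"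
        unfolding a_def l2_inner_def by (intro Bochner_Integration.integral_cong) auto
      also have "\<dots> = a S e + a S' e"
        unfolding a_def T_def
        using S e by (intro l2_inner_add_left transition_operator_L2 kernel L E)
      finally show ?thesis .
    qed
    then have "(a (S \<union> S') has_sum (s S + s S')) E"
      using has_sum_add[OF has_sum[OF S(1)] has_sum[OF S(2)]] by (rule iffD2[OF has_sum_cong])
    then show ?thesis unfolding s_def by (rule infsumI)
  qed
  have rectangle: "s (B \<times> C) = complex_of_real (measure N (B \<times> C))"
    if B: "B \<in> sets M" and C: "C \<in> sets M" for B C
  proof -
    let ?B = "\<lambda>x. complex_of_real (indicator B x)" and ?C = "\<lambda>x. complex_of_real (indicator C x)"
    have BL: "?B \<in> L2 M" and CL: "?C \<in> L2 M"
      using B C by (auto intro!: L2_bounded[of _ 1] simp: indicator_def)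
    have "a (B \<times> C) e = l2_inner M (H ?C) e * l2_inner M e ?B" if e: "e \<in> E" for e
    proof -
      have "T (B \<times> C) e x = l2_inner M e ?B * ?C x" for x
      proof -
        have "T (B \<times> C) e x = (\<integral>\<sigma>. e \<sigma> * cnj (?B \<sigma>) * ?C x \<partial>M)"
          by (simp add: T_def transition_operator_def indicator_times mult_ac)
        also have "\<dots> = l2_inner M e ?B * ?C x"
          unfolding l2_inner_def by (rule integral_mult_left_zero)
        finally show ?thesis .
      qed
      then have "T (B \<times> C) e = (\<lambda>x. l2_inner M e ?B * ?C x)" by (rule ext)
      then have "a (B \<times> C) e = l2_inner M e ?B * l2_inner M ?C (L e)"
        by (simp add: a_def l2_inner_cmult_left)
      then show ?thesis using adj[OF CL E[OF e]] by simp
    qed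
    then have "(a (B \<times> C) has_sum l2_inner M (H ?C) ?B) E"
      using l2_Parseval_inner[OF basis H[OF CL] BL] by (rule iffD2[OF has_sum_cong])
    then show ?thesis unfolding s_def using rect[OF B C] by (simp add: infsumI)
  qed
  have "s S = complex_of_real (measure N S)"
    using Int_stable_pair_measure_generator pair_measure_closed S
    unfolding sets_pair_measure
  proof (induction rule: sigma_sets_induct_disjoint)
    case (basic A)
    then show ?case using rectangle by auto
  next
    case empty
    then show ?case using rectangle[of "{}" "{}"] by simp
  next
    case (compl A)
    let ?\<Omega> = "space M \<times> space M"
    have A: "A \<in> sets (M \<Otimes>\<^sub>M M)" using compl.hyps by (simp add: sets_pair_measure)
    then have "A \<subseteq> ?\<Omega>" using sets.sets_into_space space_pair_measure by blast
    then have "A \<union> (?\<Omega> - A) = ?\<Omega>" by blast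
    then have "s (?\<Omega> - A) = s ?\<Omega> - s A" using add[of A "?\<Omega> - A"] A by simp
    moreover have "measure N (?\<Omega> - A) = measure N ?\<Omega> - measure N A"
      using A \<open>A \<subseteq> ?\<Omega>\<close> by (intro N.finite_measure_Diff) (auto simp: N(2))
    ultimately show ?case
      using rectangle[OF sets.top sets.top] compl.IH by (simp only: of_real_diff)
  next
    case (union A)
    have A: "A i \<in> sets (M \<Otimes>\<^sub>M M)" for i
      using union.hyps(2) by (auto simp: sets_pair_measure)
    have disj: "disjoint_family A" by (rule union.hyps)
    define U where "U n = (\<Union>i<n. A i)" for n
    have U: "U n \<in> sets (M \<Otimes>\<^sub>M M)" for n unfolding U_def using A by auto
    \<comment> \<open>Finite additivity settles the partial unions; the complement of a partial union has small
      measure and hence a small pairing.\<close>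
    have sU: "s (U n) = complex_of_real (measure N (U n))" for n
    proof (induction n)
      case 0
      show ?case using rectangle[of "{}" "{}"] by (simp add: U_def)
    next
      case (Suc n)
      have eq: "U (Suc n) = U n \<union> A n" by (auto simp: U_def less_Suc_eq)
      have dj: "U n \<inter> A n = {}"
      proof -
        have "A i \<inter> A n = {}" if "i < n" for i
          using that disjoint_family_onD[OF disj, of i n] by simp
        then show ?thesis by (auto simp: U_def)
      qed
      show ?case
        unfolding eq using add[OF U A dj] Suc.IH union.IH[of n] N.finite_measure_Union[OF _ _ dj] U A
        by (simp add: N(2))
    qed
    have Uall: "(\<Union>n. U n) = (\<Union>i. A i)" by (auto simp: U_def)
    have inc: "incseq U" unfolding U_def incseq_def by (intro allI impI UN_mono) auto
    have all: "(\<Union>i. A i) \<in> sets (M \<Otimes>\<^sub>M M)" using A by auto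
    have "(\<lambda>n. measure N (U n)) \<longlonglongrightarrow> measure N (\<Union>i. A i)"
      unfolding Uall[symmetric] using U inc by (intro N.finite_Lim_measure_incseq) (auto simp: N(2))
    then have lim1: "(\<lambda>n. s (U n)) \<longlonglongrightarrow> complex_of_real (measure N (\<Union>i. A i))"
      unfolding sU by (rule tendsto_of_real)
    have "(\<lambda>n. measure (M \<Otimes>\<^sub>M M) (U n)) \<longlonglongrightarrow> measure (M \<Otimes>\<^sub>M M) (\<Union>i. A i)"
      unfolding Uall[symmetric] using U inc by (intro P.finite_Lim_measure_incseq) auto
    then have "(\<lambda>n. measure (M \<Otimes>\<^sub>M M) (\<Union>i. A i) - measure (M \<Otimes>\<^sub>M M) (U n)) \<longlonglongrightarrow>
        measure (M \<Otimes>\<^sub>M M) (\<Union>i. A i) - measure (M \<Otimes>\<^sub>M M) (\<Union>i. A i)"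
      by (intro tendsto_intros)
    moreover have "measure (M \<Otimes>\<^sub>M M) (\<Union>i. A i) - measure (M \<Otimes>\<^sub>M M) (U n) =
        measure (M \<Otimes>\<^sub>M M) ((\<Union>i. A i) - U n)" for n
      using U all by (intro P.finite_measure_Diff[symmetric]) (auto simp: U_def)
    ultimately have "(\<lambda>n. measure (M \<Otimes>\<^sub>M M) ((\<Union>i. A i) - U n)) \<longlonglongrightarrow> 0" by simp
    then have "(\<lambda>n. sqrt (measure (M \<Otimes>\<^sub>M M) ((\<Union>i. A i) - U n)) * sqrt b) \<longlonglongrightarrow> sqrt 0 * sqrt b"
      by (intro tendsto_intros)
    then have lim0: "(\<lambda>n. sqrt (measure (M \<Otimes>\<^sub>M M) ((\<Union>i. A i) - U n)) * sqrt b) \<longlonglongrightarrow> 0" by simp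
    have "(\<lambda>n. s ((\<Union>i. A i) - U n)) \<longlonglongrightarrow> 0"
      by (rule Lim_null_comparison[OF _ lim0]) (use U all in \<open>auto intro!: small always_eventually\<close>)
    from tendsto_add[OF lim1 this]
    have "(\<lambda>n. s (U n) + s ((\<Union>i. A i) - U n)) \<longlonglongrightarrow> complex_of_real (measure N (\<Union>i. A i))" by simp
    moreover have "s (U n) + s ((\<Union>i. A i) - U n) = s (\<Union>i. A i)" for n
    proof -
      have "U n \<union> ((\<Union>i. A i) - U n) = (\<Union>i. A i)" by (auto simp: U_def)
      then show ?thesis using add[of "U n" "(\<Union>i. A i) - U n"] U all by simp
    qed
    ultimately show ?case by (simp add: LIMSEQ_const_iff)
  qed
  then show ?thesis using has_sum[OF S] by (simp add: a_def[abs_def] T_def)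
qed

lemma finite_measure_PiM:
  assumes "finite I"
  shows "finite_measure (PiM I (\<lambda>_. M))"
proof -
  interpret product_sigma_finite "\<lambda>_. M" ..
  show ?thesis
    using assms by (intro finite_measureI) (simp add: space_PiM emeasure_PiM ennreal_prod_eq_top del: prod_constant)
qed

text \<open>
  Integrating out the last letter replaces $g$ by its image under the transposed operator and
  shortens the path by one edge; transposition then moves that operator to the other factor.
\<close>

lemma path_integral:
  assumes k: "unit_kernel M k"
    and f: "f \<in> borel_measurable M" "\<And>x. x \<in> space M \<Longrightarrow> norm (f x) \<le> a"
    and g: "g \<in> borel_measurable M" "\<And>x. x \<in> space M \<Longrightarrow> norm (g x) \<le> b"
  shows "(\<integral>x. f (x 0) * (\<Prod>i<m. complex_of_real (k (x i) (x (Suc i)))) * g (x m)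
      \<partial>PiM {..<Suc m} (\<lambda>_. M)) = (\<integral>x. (transition_operator M k ^^ m) f x * g x \<partial>M)"
  using g
proof (induction m arbitrary: g b)
  case 0
  interpret product_sigma_finite "\<lambda>_. M" ..
  note [measurable] = f(1) 0(1)
  have "{..<Suc 0} = {0::nat}" by auto
  then show ?case using product_integral_singleton[of "\<lambda>x. f x * g x" 0] by simp
next
  case (Suc m)
  interpret product_sigma_finite "\<lambda>_. M" ..
  let ?k' = "\<lambda>x y. k y x"
  let ?P = "PiM {..<Suc (Suc m)} (\<lambda>_. M)"
  let ?F = "\<lambda>x. f (x 0) * (\<Prod>i<Suc m. complex_of_real (k (x i) (x (Suc i)))) * g (x (Suc m))"
  interpret P: finite_measure ?P by (rule finite_measure_PiM) simp
  have k': "unit_kernel M ?k'" by (rule unit_kernel_transpose[OF k])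
  have fL: "f \<in> L2 M" and gL: "g \<in> L2 M"
    using f Suc.prems by (auto intro: L2_bounded)
  have "integrable ?P ?F"
  proof (rule P.integrable_const_bound[where B = "a * 1 * b"])
    have comp: "(\<lambda>x. x i) \<in> measurable ?P M" if "i < Suc (Suc m)" for i
      using that by (intro measurable_component_singleton) simp
    have edge: "(\<lambda>x. complex_of_real (k (x i) (x (Suc i)))) \<in> borel_measurable ?P"
      if "i \<in> {..<Suc m}" for i
    proof -
      have [measurable]: "(\<lambda>x. k (x i) (x (Suc i))) \<in> borel_measurable ?P"
        using that by (intro unit_kernel_measurable[OF k] comp) auto
      show ?thesis by measurable
    qed
    show "?F \<in> borel_measurable ?P"
      by (intro borel_measurable_times borel_measurable_prod edge
          measurable_compose[OF comp f(1)] measurable_compose[OF comp Suc.prems(1)]) auto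
    show "AE x in ?P. norm (?F x) \<le> a * 1 * b"
    proof (rule AE_I2)
      fix x assume x: "x \<in> space ?P"
      then have "x 0 \<in> space M" "x (Suc m) \<in> space M" by (auto simp: space_PiM PiE_iff)
      moreover have "norm (\<Prod>i<Suc m. complex_of_real (k (x i) (x (Suc i)))) \<le> 1"
        unfolding prod_norm[symmetric] using unit_kernel_abs_le[OF k] by (intro prod_le_1) auto
      ultimately show "norm (?F x) \<le> a * 1 * b"
        unfolding norm_mult using f(2) Suc.prems(2)
        by (intro mult_mono) (auto intro: order_trans[OF norm_ge_zero] mult_nonneg_nonneg)
    qed
  qed
  moreover have "{..<Suc (Suc m)} = insert (Suc m) {..<Suc m}" by auto
  ultimately have "(\<integral>x. ?F x \<partial>?P) =
      (\<integral>x. (\<integral>y. ?F (x(Suc m := y)) \<partial>M) \<partial>PiM {..<Suc m} (\<lambda>_. M))"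
    using product_integral_insert[of "{..<Suc m}" "Suc m" ?F] by simp
  also have "\<dots> = (\<integral>x. f (x 0) * (\<Prod>i<m. complex_of_real (k (x i) (x (Suc i)))) *
      transition_operator M ?k' g (x m) \<partial>PiM {..<Suc m} (\<lambda>_. M))"
  proof (rule Bochner_Integration.integral_cong[OF refl])
    fix x
    have "?F (x(Suc m := y)) = f (x 0) * (\<Prod>i<m. complex_of_real (k (x i) (x (Suc i)))) *
        (complex_of_real (k (x m) y) * g y)" for y
      by simp
    then show "(\<integral>y. ?F (x(Suc m := y)) \<partial>M) =
        f (x 0) * (\<Prod>i<m. complex_of_real (k (x i) (x (Suc i)))) * transition_operator M ?k' g (x m)"
      by (simp only: transition_operator_def integral_mult_right_zero)
  qed
  also have "\<dots> = (\<integral>x. (transition_operator M k ^^ m) f x * transition_operator M ?k' g x \<partial>M)"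
    by (rule Suc.IH[OF transition_operator_measurable[OF k' Suc.prems(1)]
          transition_operator_le_L1[OF k' _ L2_imp_integrable[OF gL]]])
  also have "\<dots> = (\<integral>x. (transition_operator M k ^^ Suc m) f x * g x \<partial>M)"
    using transition_operator_transpose[OF k transition_operator_power_L2[OF k fL] gL, of m]
    by simp
  finally show ?case .
qed

end

text \<open>
  The first application of the operator supplies square-summability; the remaining ones are
  bounded.
\<close>

lemma (in finite_measure) transition_operator_power_Hilbert_Schmidt:
  assumes k: "unit_kernel M k" and on: "l2_orthonormal M E" and F: "finite F" "F \<subseteq> E"
  shows "(\<Sum>e\<in>F. (l2_norm M ((transition_operator M k ^^ Suc m) e))\<^sup>2) \<le>
    (measure M (space M) ^ m)\<^sup>2 * (\<integral>p. (k (fst p) (snd p))\<^sup>2 \<partial>(M \<Otimes>\<^sub>M M))"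
proof -
  have "(\<Sum>e\<in>F. (l2_norm M ((transition_operator M k ^^ Suc m) e))\<^sup>2) \<le>
      (\<Sum>e\<in>F. (measure M (space M) ^ m)\<^sup>2 * (l2_norm M (transition_operator M k e))\<^sup>2)"
  proof (rule sum_mono)
    fix e assume "e \<in> F"
    then have "transition_operator M k e \<in> L2 M"
      using F by (intro transition_operator_L2 k l2_orthonormal_L2[OF on]) auto
    from transition_operator_power_norm_le[OF k this, of m]
    have "l2_norm M ((transition_operator M k ^^ Suc m) e) \<le>
        measure M (space M) ^ m * l2_norm M (transition_operator M k e)"
      by (simp only: funpow_Suc_right comp_apply)
    from power_mono[OF this l2_norm_nonneg, of 2]
    show "(l2_norm M ((transition_operator M k ^^ Suc m) e))\<^sup>2 \<le>
        (measure M (space M) ^ m)\<^sup>2 * (l2_norm M (transition_operator M k e))\<^sup>2"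
      by (simp only: power_mult_distrib)
  qed
  also have "\<dots> = (measure M (space M) ^ m)\<^sup>2 * (\<Sum>e\<in>F. (l2_norm M (transition_operator M k e))\<^sup>2)"
    by (simp only: sum_distrib_left)
  also have "\<dots> \<le> (measure M (space M) ^ m)\<^sup>2 * (\<integral>p. (k (fst p) (snd p))\<^sup>2 \<partial>(M \<Otimes>\<^sub>M M))"
    by (intro mult_left_mono transition_operator_Hilbert_Schmidt[OF k on F]) simp
  finally show ?thesis .
qed

lemma (in finite_measure) l2_trace_class_transition_power:
  assumes k: "unit_kernel M k"
  shows "l2_trace_class M (transition_operator M k ^^ Suc (Suc m))"
proof -
  obtain E where basis: "l2_orthonormal_basis M E" using l2_orthonormal_basis_exists by blast
  note on = l2_orthonormal_basisD[OF basis]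
  note k' = unit_kernel_transpose[OF k]
  have "transition_operator M k ^^ Suc (Suc m) =
      (\<lambda>f. transition_operator M k ((transition_operator M k ^^ Suc m) f))" by (auto simp: fun_eq_iff)
  moreover have "l2_trace_class M \<dots>"
  proof (rule l2_trace_class_comp[OF basis l2_operator_transition[OF k] l2_operator_transition_power[OF k]
        _ _ transition_operator_power_adjoint[OF k]
        transition_operator_Hilbert_Schmidt[OF k on]
        transition_operator_power_Hilbert_Schmidt[OF k' on]])
    show "l2_operator M (\<lambda>f. transition_operator M k ((transition_operator M k ^^ Suc m) f))"
      using l2_operator_transition_power[OF k, of "Suc (Suc m)"] by (simp add: comp_def)
  qed (rule transition_operator_power_L2[OF k'])
  ultimately show ?thesis by simp
qed

section \<open>Periodic points, cyclic words and the trace formula\<close>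

lemma left_shift_funpow: "(left_shift ^^ n) \<xi> = (\<lambda>k. \<xi> (k + n))"
  by (induction n arbitrary: \<xi>) (auto simp: left_shift_def fun_eq_iff)

text \<open>
  A point of period $n$ is the periodic extension of its initial word, so the only condition
  beyond the inner transitions is that the last letter may be followed by the first one.
\<close>

lemma initial_words_of_periodic_points:
  assumes "n > 0"
  shows "initial_word n ` {\<xi> \<in> config_space \<AA>. (left_shift ^^ n) \<xi> = \<xi>} =
    {x \<in> extensional {..<n}. \<forall>i<n. \<AA> (x i) (x (Suc i mod n)) = 1}"
proof (intro equalityI subsetI)
  fix x assume "x \<in> initial_word n ` {\<xi> \<in> config_space \<AA>. (left_shift ^^ n) \<xi> = \<xi>}"
  then obtain \<xi> where x: "x = initial_word n \<xi>" and \<xi>: "\<xi> \<in> config_space \<AA>"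
    and per: "(left_shift ^^ n) \<xi> = \<xi>" by auto
  from per have "\<xi> n = \<xi> 0" by (simp add: left_shift_funpow fun_eq_iff) (metis add_0)
  then have "\<xi> (Suc i mod n) = \<xi> (Suc i)" if "i < n" for i
    using that by (cases "Suc i = n") auto
  then have "\<AA> (x i) (x (Suc i mod n)) = 1" if "i < n" for i
    using that \<xi> assms by (simp add: x initial_word_def config_space_def)
  then show "x \<in> {x \<in> extensional {..<n}. \<forall>i<n. \<AA> (x i) (x (Suc i mod n)) = 1}"
    by (simp add: x initial_word_def)
next
  fix x assume x: "x \<in> {x \<in> extensional {..<n}. \<forall>i<n. \<AA> (x i) (x (Suc i mod n)) = 1}"
  let ?\<xi> = "periodic_extension n x"
  have "\<AA> (x (i mod n)) (x (Suc i mod n)) = 1" for i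
    using x assms mod_less_divisor[of n i] by (metis (mono_tags, lifting) mem_Collect_eq mod_Suc_eq)
  then have "?\<xi> \<in> config_space \<AA>" by (simp add: config_space_def periodic_extension_def)
  moreover have "(left_shift ^^ n) ?\<xi> = ?\<xi>"
    by (simp add: left_shift_funpow periodic_extension_def)
  moreover have "x = initial_word n ?\<xi>"
    using x by (auto simp: initial_word_def periodic_extension_def extensional_def fun_eq_iff)
  ultimately show "x \<in> initial_word n ` {\<xi> \<in> config_space \<AA>. (left_shift ^^ n) \<xi> = \<xi>}" by blast
qed

text \<open>
  Splitting off the closing edge: the path condition on the first edges stays fixed while the set
  of admissible closing edges varies.
\<close>

lemma cyclic_word_iff:
  "(\<forall>i<Suc m. \<AA> (x i) (x (Suc i mod Suc m)) = 1) \<longleftrightarrow>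
    (\<forall>i<m. \<AA> (x i) (x (Suc i)) = 1) \<and> \<AA> (x m) (x 0) = 1"
proof -
  have "Suc i mod Suc m = Suc i" if "i < m" for i using that by (intro mod_less) simp
  then show ?thesis unfolding All_less_Suc by auto
qed

lemma prod_zero_one_eq_indicator:
  fixes c :: "'b \<Rightarrow> real"
  assumes "finite I" "\<And>i. i \<in> I \<Longrightarrow> c i \<in> {0, 1}"
  shows "(\<Prod>i\<in>I. complex_of_real (c i)) = (if \<forall>i\<in>I. c i = 1 then 1 else 0)"
proof (cases "\<forall>i\<in>I. c i = 1")
  case False
  then obtain i where "i \<in> I" "c i = 0" using assms(2) by auto
  with assms(1) False show ?thesis by (auto intro!: prod_zero)
qed simp

context matrix_subshift
begin

lemma unit_kernel_transition_matrix: "unit_kernel \<nu> \<AA>"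
proof -
  have "\<bar>\<AA> x y\<bar> \<le> 1" for x y using transition_matrix_values[of x y] by auto
  then show ?thesis using transition_matrix_measurable by (simp add: unit_kernel_def)
qed

definition cyclic_words :: "nat \<Rightarrow> (nat \<Rightarrow> 'a) set" where
  "cyclic_words n = {x \<in> space (PiM {..<n} (\<lambda>_. \<nu>)). \<forall>i<n. \<AA> (x i) (x (Suc i mod n)) = 1}"

lemma cyclic_words_eq:
  "n > 0 \<Longrightarrow> cyclic_words n = initial_word n ` {\<xi> \<in> config_space \<AA>. (left_shift ^^ n) \<xi> = \<xi>}"
  unfolding initial_words_of_periodic_points cyclic_words_def
  by (simp add: space_PiM space_eq_UNIV PiE_UNIV_domain PiE_def)

lemma edge_measurable:
  assumes "i < n" "j < n"
  shows "(\<lambda>x. \<AA> (x i) (x j)) \<in> borel_measurable (PiM {..<n} (\<lambda>_. \<nu>))"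
  using assms
  by (intro unit_kernel_measurable[OF unit_kernel_transition_matrix] measurable_component_singleton) auto

lemma cyclic_words_measurable:
  assumes "n > 0"
  shows "cyclic_words n \<in> sets (PiM {..<n} (\<lambda>_. \<nu>))"
proof -
  have [measurable]: "(\<lambda>x. \<AA> (x i) (x (Suc i mod n))) \<in> borel_measurable (PiM {..<n} (\<lambda>_. \<nu>))"
    if "i < n" for i
    using that assms by (intro edge_measurable) auto
  show ?thesis unfolding cyclic_words_def by measurable
qed

lemma dyn_partition_function_zero_interaction:
  assumes "n > 0"
  shows "dyn_partition_function \<nu> \<AA> (\<lambda>_. 0) n =
    complex_of_real (measure (PiM {..<n} (\<lambda>_. \<nu>)) (cyclic_words n))"
proof -
  have "dyn_partition_function \<nu> \<AA> (\<lambda>_. 0) n =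
      (\<integral>x. complex_of_real (indicator (cyclic_words n) x) \<partial>PiM {..<n} (\<lambda>_. \<nu>))"
    unfolding dyn_partition_function_def
  proof (rule Bochner_Integration.integral_cong[OF refl])
    fix x assume "x \<in> space (PiM {..<n} (\<lambda>_. \<nu>))"
    then show "(\<Prod>i<n. complex_of_real (\<AA> (x i) (x (Suc i mod n)))) * exp (\<Sum>k<n. 0) =
        complex_of_real (indicator (cyclic_words n) x)"
      using transition_matrix_values
      by (subst prod_zero_one_eq_indicator) (auto simp: cyclic_words_def indicator_def)
  qed
  also have "\<dots> = complex_of_real (measure (PiM {..<n} (\<lambda>_. \<nu>)) (cyclic_words n))"
    unfolding integral_complex_of_real using cyclic_words_measurable[OF assms] by simp
  finally show ?thesis .
qed

text \<open>
  The pairing of the transition operator with the adjoint of its remaining power, evaluated by the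
  measure that assigns to $S$ the mass of the paths whose closing edge lies in $S$.
\<close>

lemma trace_has_sum_cyclic_words:
  assumes basis: "l2_orthonormal_basis \<nu> E"
  shows "((\<lambda>e. l2_inner \<nu> ((transition_operator \<nu> \<AA> ^^ Suc (Suc m)) e) e) has_sum
    complex_of_real (measure (PiM {..<Suc (Suc m)} (\<lambda>_. \<nu>)) (cyclic_words (Suc (Suc m))))) E"
proof -
  let ?n = "Suc (Suc m)"
  let ?P = "PiM {..<?n} (\<lambda>_. \<nu>)"
  let ?T = "transition_operator \<nu> \<AA>" and ?T' = "transition_operator \<nu> (\<lambda>x y. \<AA> y x)"
  note k = unit_kernel_transition_matrix
  note k' = unit_kernel_transpose[OF k]
  note on = l2_orthonormal_basisD[OF basis]
  interpret P: finite_measure ?P by (rule finite_measure_PiM) simp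
  define S where "S = {(x, y). \<AA> x y = 1}"
  define W where "W = {x \<in> space ?P. \<forall>i<Suc m. \<AA> (x i) (x (Suc i)) = 1}"
  define ends where "ends = (\<lambda>x. (x (Suc m), x 0) :: 'a \<times> 'a)"
  have [measurable]: "(\<lambda>x. \<AA> (x i) (x (Suc i))) \<in> borel_measurable ?P" if "i < Suc m" for i
    using that by (intro edge_measurable) auto
  have W: "W \<in> sets ?P" unfolding W_def by measurable
  have ends: "ends \<in> measurable ?P (\<nu> \<Otimes>\<^sub>M \<nu>)"
    unfolding ends_def by (intro measurable_Pair measurable_component_singleton) auto
  \<comment> \<open>The distribution of the closing edge, from the last letter to the first, under the measure
    restricted to the paths in \<open>W\<close>.\<close>
  define N where "N = distr (density ?P (indicator W)) (\<nu> \<Otimes>\<^sub>M \<nu>) ends"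
  have N: "measure N X = measure ?P (W \<inter> (ends -` X \<inter> space ?P))" if "X \<in> sets (\<nu> \<Otimes>\<^sub>M \<nu>)" for X
    using that ends W measurable_sets[OF ends that] by (simp add: N_def measure_distr measure_restricted)
  have "finite_measure (density ?P (indicator W))"
    using W by (intro finite_measureI) (simp add: emeasure_restricted)
  then have finite_N: "finite_measure N"
    unfolding N_def using ends by (intro finite_measure.finite_measure_distr) auto
  have sets_N: "sets N = sets (\<nu> \<Otimes>\<^sub>M \<nu>)" by (simp add: N_def)
  have S: "S \<in> sets (\<nu> \<Otimes>\<^sub>M \<nu>)"
  proof -
    have "S = (\<lambda>(x, y). \<AA> x y) -` {1} \<inter> space (\<nu> \<Otimes>\<^sub>M \<nu>)"
      by (auto simp: S_def space_pair_measure space_eq_UNIV)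
    then show ?thesis using measurable_sets[OF transition_matrix_measurable, of "{1}"] by simp
  qed
  have indicator_S: "(\<lambda>\<sigma> x. indicat_real S (\<sigma>, x)) = \<AA>"
    using transition_matrix_values by (auto simp: S_def indicator_def fun_eq_iff)
  have rect: "l2_inner \<nu> ((?T ^^ Suc m) (\<lambda>x. complex_of_real (indicator C x)))
      (\<lambda>x. complex_of_real (indicator B x)) = complex_of_real (measure N (B \<times> C))"
    if B: "B \<in> sets \<nu>" and C: "C \<in> sets \<nu>" for B C
  proof -
    let ?B = "\<lambda>x. complex_of_real (indicator B x)" and ?C = "\<lambda>x. complex_of_real (indicator C x)"
    let ?X = "W \<inter> (ends -` (B \<times> C) \<inter> space ?P)"
    have "l2_inner \<nu> ((?T ^^ Suc m) ?C) ?B = (\<integral>x. (?T ^^ Suc m) ?C x * ?B x \<partial>\<nu>)"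
      by (simp add: l2_inner_def)
    also have "\<dots> = (\<integral>x. ?C (x 0) * (\<Prod>i<Suc m. complex_of_real (\<AA> (x i) (x (Suc i)))) * ?B (x (Suc m)) \<partial>?P)"
      using B C by (intro path_integral[OF k, where a = 1 and b = 1, symmetric]) (auto simp: indicator_def)
    also have "\<dots> = (\<integral>x. complex_of_real (indicator ?X x) \<partial>?P)"
    proof (rule Bochner_Integration.integral_cong[OF refl])
      fix x assume "x \<in> space ?P"
      then show "?C (x 0) * (\<Prod>i<Suc m. complex_of_real (\<AA> (x i) (x (Suc i)))) * ?B (x (Suc m)) =
          complex_of_real (indicator ?X x)"
        using transition_matrix_values
        by (subst prod_zero_one_eq_indicator) (auto simp: W_def ends_def indicator_def)
    qed
    also have "\<dots> = complex_of_real (measure N (B \<times> C))"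
      unfolding integral_complex_of_real using W measurable_sets[OF ends, of "B \<times> C"] B C
      by (simp add: N)
    finally show ?thesis .
  qed
  have "((\<lambda>e. l2_inner \<nu> (transition_operator \<nu> (\<lambda>\<sigma> x. indicator S (\<sigma>, x)) e) ((?T' ^^ Suc m) e))
      has_sum complex_of_real (measure N S)) E"
  proof (rule pairing_has_sum_measure[OF basis, where H = "?T ^^ Suc m"])
    show "l2_inner \<nu> ((?T ^^ Suc m) f) g = l2_inner \<nu> f ((?T' ^^ Suc m) g)"
      if "f \<in> L2 \<nu>" "g \<in> L2 \<nu>" for f g
      using that by (rule transition_operator_power_adjoint[OF k])
  qed (fact transition_operator_power_L2[OF k]
      transition_operator_power_L2[OF k']
      transition_operator_power_Hilbert_Schmidt[OF k' on] finite_N sets_N rect S)+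
  then have pairing: "((\<lambda>e. l2_inner \<nu> (?T e) ((?T' ^^ Suc m) e)) has_sum complex_of_real (measure N S)) E"
    by (simp only: indicator_S)
  have cyclic: "measure N S = measure ?P (cyclic_words ?n)"
  proof -
    have "W \<inter> (ends -` S \<inter> space ?P) = cyclic_words ?n"
      unfolding cyclic_words_def cyclic_word_iff W_def by (auto simp: ends_def S_def)
    then show ?thesis using N[OF S] by simp
  qed
  have trace: "l2_inner \<nu> (?T e) ((?T' ^^ Suc m) e) = l2_inner \<nu> ((?T ^^ ?n) e) e" if "e \<in> E" for e
  proof -
    have e: "e \<in> L2 \<nu>" using on that by (rule l2_orthonormal_L2)
    show ?thesis
      unfolding funpow_Suc_right[of "Suc m" ?T] comp_apply
      by (rule transition_operator_power_adjoint[OF k transition_operator_L2[OF k e] e, symmetric])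
  qed
  show ?thesis by (rule iffD1[OF has_sum_cong[OF trace] pairing[unfolded cyclic]])
qed

end

theorem proposition5p1:
  fixes \<nu> :: "'a::t2_space measure" and \<AA> :: "'a \<Rightarrow> 'a \<Rightarrow> real" and n :: nat
  assumes "matrix_subshift \<nu> \<AA> (\<lambda>_. 0)"
    and "n \<ge> 2"
  shows "l2_operator \<nu> (transition_operator \<nu> \<AA>)
    \<and> l2_trace_class \<nu> (transition_operator \<nu> \<AA> ^^ n)
    \<and> initial_word n ` {\<xi> \<in> config_space \<AA>. (left_shift ^^ n) \<xi> = \<xi>}
        \<in> sets (PiM {..<n} (\<lambda>_. \<nu>))
    \<and> dyn_partition_function \<nu> \<AA> (\<lambda>_. 0) n
        = complex_of_real (measure (PiM {..<n} (\<lambda>_. \<nu>))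
            (initial_word n ` {\<xi> \<in> config_space \<AA>. (left_shift ^^ n) \<xi> = \<xi>}))
    \<and> complex_of_real (measure (PiM {..<n} (\<lambda>_. \<nu>))
            (initial_word n ` {\<xi> \<in> config_space \<AA>. (left_shift ^^ n) \<xi> = \<xi>}))
        = l2_trace \<nu> (transition_operator \<nu> \<AA> ^^ n)"
proof -
  interpret matrix_subshift \<nu> \<AA> "\<lambda>_. 0" by (rule assms(1))
  obtain m where n: "n = Suc (Suc m)" using assms(2) by (metis Suc_le_D numeral_2_eq_2 Suc_le_mono)
  have n0: "n > 0" using assms(2) by simp
  have "l2_orthonormal_basis \<nu> (SOME E. l2_orthonormal_basis \<nu> E)"
    using l2_orthonormal_basis_exists by (rule someI_ex)
  from infsumI[OF trace_has_sum_cyclic_words[OF this]]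
  have "l2_trace \<nu> (transition_operator \<nu> \<AA> ^^ n) =
      complex_of_real (measure (PiM {..<n} (\<lambda>_. \<nu>)) (cyclic_words n))"
    by (simp only: l2_trace_def n)
  then show ?thesis
    using l2_operator_transition[OF unit_kernel_transition_matrix]
      l2_trace_class_transition_power[OF unit_kernel_transition_matrix, of m]
      cyclic_words_measurable[OF n0] dyn_partition_function_zero_interaction[OF n0]
    unfolding cyclic_words_eq[OF n0, symmetric] n[symmetric] by simp
qed

end
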